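(* Let $Q=(q_{\mathbf{ij}};\mathbf i,\mathbf j\in\mathbf Z_+^n)$ be an $n$TBI $q$-matrix satisfying (A-1), (A-2), (A-3). Then there exists exactly one $n$TBIP with $q$-matrix $Q$, i.e. exactly one transition function $P(t)=(p_{\mathbf{ij}}(t);\mathbf i,\mathbf j\in\mathbf Z_+^n)$ satisfying the Kolmogorov forward equation $P'(t)=P(t)Q$; it is the Feller minimal $Q$-function.
   Context: Fix $n\ge1$. For $\mathbf i=(i_1,\dots,i_n)\in\mathbf Z_+^n$ ($\mathbf Z_+=\{0,1,2,\dots\}$) write $|\mathbf i|=\sum_k i_k$; $\mathbf 0=(0,\dots,0)$, $\mathbf e_k$ is the $k$-th unit vector, and $\chi$ is the indicator function of $\mathbf Z_+^n$. An $n$-type branching with immigration $q$-matrix ($n$TBI $q$-matrix) is a matrix $Q=(q_{\mathbf{ij}})$ on $\mathbf Z_+^n$ with $q_{\mathbf{0j}}=h_{\mathbf j}$ and, for $|\mathbf i|>0$, $$q_{\mathbf{ij}}=\sum_{k=1}^n i_k b^{(k)}_{\mathbf j-\mathbf i+\mathbf e_k}\chi(\mathbf j-\mathbf i+\mathbf e_k)+a_{\mathbf j-\mathbf i}\chi(\mathbf j-\mathbf i),$$ where $h_{\mathbf j}\ge0$ and $a_{\mathbf j}\ge 0$ for $\mathbf j\ne\mathbf 0$, $0<\sum_{\mathbf j\ne\mathbf 0}h_{\mathbf j}=-h_{\mathbf 0}<\infty$, $0<\sum_{\mathbf j\ne\mathbf 0}a_{\mathbf j}=-a_{\mathbf 0}<\infty$,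 and for $k=1,\dots,n$: $b^{(k)}_{\mathbf j}\ge0$ ($\mathbf j\neq\mathbf e_k$), $0<\sum_{\mathbf j\ne\mathbf e_k}b^{(k)}_{\mathbf j}=-b^{(k)}_{\mathbf e_k}<\infty$. An $n$TBIP is a continuous-time Markov chain on $\mathbf Z_+^n$ whose (standard, possibly dishonest) transition function $P(t)$ satisfies $P'(t)=P(t)Q$ for an $n$TBI $q$-matrix $Q$. Let $B_i(u_1,\dots,u_n)=\sum_{\mathbf j}b^{(i)}_{\mathbf j}u_1^{j_1}\cdots u_n^{j_n}$, $B_{ij}=\partial B_i/\partial u_j$, $g_{ij}=\delta_{ij}-B_{ij}/b^{(i)}_{\mathbf e_i}$, $G=(g_{ij})$. Assumptions: (A-1) $\{B_i\}$ is nonsingular, i.e. there is no $n\times n$ matrix $M$ with $(B_1(u),\dots,B_n(u))^{T}=M(u_1,\dots,u_n)^{T}$ for all $u$; (A-2) $B_{ij}(1,\dots,1)<\infty$ for all $i,j$; (A-3) $G(1,\dots,1)$ is positively regular, i.e. some power of it has all entries strictly positive. *)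

theory Defs
  imports "HOL-Analysis.Analysis"
begin

text \<open>Transition functions are standard and possibly dishonest. Only the values at times
  \<open>t \<ge> 0\<close> matter.\<close>

definition transition_function :: "(real \<Rightarrow> 's \<Rightarrow> 's \<Rightarrow> real) \<Rightarrow> bool" where
  "transition_function P \<longleftrightarrow>
     (\<forall>t\<ge>0. \<forall>i j. 0 \<le> P t i j) \<and>
     (\<forall>t\<ge>0. \<forall>i. P t i summable_on UNIV \<and> (\<Sum>\<^sub>\<infinity>j. P t i j) \<le> 1) \<and>
     (\<forall>i j. P 0 i j = of_bool (i = j)) \<and>
     (\<forall>s\<ge>0. \<forall>t\<ge>0. \<forall>i j. ((\<lambda>k. P s i k * P t k j) has_sum P (s + t) i j) UNIV) \<and>
     (\<forall>i j. ((\<lambda>t. P t i j) \<longlongrightarrow> of_bool (i = j)) (at_right 0))"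

definition Q_function :: "('s \<Rightarrow> 's \<Rightarrow> real) \<Rightarrow> (real \<Rightarrow> 's \<Rightarrow> 's \<Rightarrow> real) \<Rightarrow> bool" where
  "Q_function Q P \<longleftrightarrow> transition_function P \<and>
     (\<forall>i j. ((\<lambda>t. P t i j) has_real_derivative Q i j) (at 0 within {0..}))"

definition Feller_minimal :: "('s \<Rightarrow> 's \<Rightarrow> real) \<Rightarrow> (real \<Rightarrow> 's \<Rightarrow> 's \<Rightarrow> real) \<Rightarrow> bool" where
  "Feller_minimal Q F \<longleftrightarrow> Q_function Q F \<and>
     (\<forall>P. Q_function Q P \<longrightarrow> (\<forall>t\<ge>0. \<forall>i j. F t i j \<le> P t i j))"

text \<open>\<open>P'(t) = P(t) Q\<close> for all \<open>t \<ge> 0\<close>, with the one-sided derivative at \<open>t = 0\<close>.\<close>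

definition forward_equation ::
  "('s \<Rightarrow> 's \<Rightarrow> real) \<Rightarrow> (real \<Rightarrow> 's \<Rightarrow> 's \<Rightarrow> real) \<Rightarrow> bool" where
  "forward_equation Q P \<longleftrightarrow>
     (\<forall>t\<ge>0. \<forall>i j. (\<lambda>k. P t i k * Q k j) summable_on UNIV \<and>
        ((\<lambda>s. P s i j) has_real_derivative (\<Sum>\<^sub>\<infinity>k. P t i k * Q k j)) (at t within {0..}))"

text \<open>A state is a vector \<open>i :: nat ^ 'n\<close>, with \<open>n = CARD('n)\<close>; the unit vector
  \<open>e\<^sub>k\<close> is \<open>axis k 1\<close>. Subtraction of states truncates, but \<open>j - i + e\<^sub>k\<close> lies in
  \<open>\<int>\<^sub>+\<^sup>n\<close> iff \<open>i \<le> j + e\<^sub>k\<close> componentwise, and then it equals the natural-number vector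
  \<open>j + axis k 1 - i\<close>. The guards below are the factors \<open>\<chi>\<close>.\<close>

definition nTBI_matrix ::
  "(nat ^ 'n \<Rightarrow> real) \<Rightarrow> (nat ^ 'n \<Rightarrow> real) \<Rightarrow> ('n \<Rightarrow> nat ^ 'n \<Rightarrow> real) \<Rightarrow>
   nat ^ 'n \<Rightarrow> nat ^ 'n \<Rightarrow> real" where
  "nTBI_matrix h a b i j =
     (if i = 0 then h j
      else (\<Sum>k\<in>UNIV. real (i $ k) * (if i \<le> j + axis k 1 then b k (j + axis k 1 - i) else 0))
           + (if i \<le> j then a (j - i) else 0))"

definition nTBI_qmatrix ::
  "(nat ^ 'n \<Rightarrow> real) \<Rightarrow> (nat ^ 'n \<Rightarrow> real) \<Rightarrow> ('n \<Rightarrow> nat ^ 'n \<Rightarrow> real) \<Rightarrow>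
   (nat ^ 'n \<Rightarrow> nat ^ 'n \<Rightarrow> real) \<Rightarrow> bool" where
  "nTBI_qmatrix h a b Q \<longleftrightarrow>
     (\<forall>j. j \<noteq> 0 \<longrightarrow> 0 \<le> h j) \<and> 0 < - h 0 \<and> (h has_sum (- h 0)) (UNIV - {0}) \<and>
     (\<forall>j. j \<noteq> 0 \<longrightarrow> 0 \<le> a j) \<and> 0 < - a 0 \<and> (a has_sum (- a 0)) (UNIV - {0}) \<and>
     (\<forall>k. (\<forall>j. j \<noteq> axis k 1 \<longrightarrow> 0 \<le> b k j) \<and> 0 < - b k (axis k 1) \<and>
          (b k has_sum (- b k (axis k 1))) (UNIV - {axis k 1})) \<and>
     Q = nTBI_matrix h a b"

definition nTBIP ::
  "(nat ^ 'n \<Rightarrow> nat ^ 'n \<Rightarrow> real) \<Rightarrow> (real \<Rightarrow> nat ^ 'n \<Rightarrow> nat ^ 'n \<Rightarrow> real) \<Rightarrow> bool" where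
  "nTBIP Q P \<longleftrightarrow>
     (\<exists>h a b. nTBI_qmatrix h a b Q) \<and> transition_function P \<and> forward_equation Q P"

text \<open>The series for \<open>B\<^sub>i\<close> converges absolutely on the cube \<open>\<bar>u\<^sub>k\<bar> \<le> 1\<close>, which is taken as
  its domain.\<close>

definition gen_B :: "('n \<Rightarrow> nat ^ 'n \<Rightarrow> real) \<Rightarrow> 'n::finite \<Rightarrow> real ^ 'n \<Rightarrow> real" where
  "gen_B b i u = (\<Sum>\<^sub>\<infinity>j. b i j * (\<Prod>k\<in>UNIV. (u $ k) ^ (j $ k)))"

definition nonsingular_B :: "('n::finite \<Rightarrow> nat ^ 'n \<Rightarrow> real) \<Rightarrow> bool" where
  "nonsingular_B b \<longleftrightarrow>
     \<not> (\<exists>M :: real ^ 'n ^ 'n. \<forall>u. (\<forall>k. \<bar>u $ k\<bar> \<le> 1) \<longrightarrow> (\<chi> i. gen_B b i u) = M *v u)"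

text \<open>The partial derivative \<open>\<partial>B\<^sub>i/\<partial>u\<^sub>j\<close> is taken within the domain, so that it is one-sided
  on the boundary of the cube. In particular \<open>B\<^sub>i\<^sub>j(1,\<dots>,1)\<close> is finite iff the left-hand
  difference quotients at \<open>1\<close>, which increase to \<open>B\<^sub>i\<^sub>j(1,\<dots>,1)\<close>, have a finite limit.\<close>

definition B_slice ::
  "('n \<Rightarrow> nat ^ 'n \<Rightarrow> real) \<Rightarrow> 'n::finite \<Rightarrow> 'n \<Rightarrow> real ^ 'n \<Rightarrow> real \<Rightarrow> real" where
  "B_slice b i j u s = gen_B b i (\<chi> k. if k = j then s else u $ k)"

definition B_partial_finite ::
  "('n \<Rightarrow> nat ^ 'n \<Rightarrow> real) \<Rightarrow> 'n::finite \<Rightarrow> 'n \<Rightarrow> real ^ 'n \<Rightarrow> bool" where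
  "B_partial_finite b i j u \<longleftrightarrow> B_slice b i j u differentiable (at (u $ j) within {-1..1})"

definition B_partial ::
  "('n \<Rightarrow> nat ^ 'n \<Rightarrow> real) \<Rightarrow> 'n::finite \<Rightarrow> 'n \<Rightarrow> real ^ 'n \<Rightarrow> real" where
  "B_partial b i j u = vector_derivative (B_slice b i j u) (at (u $ j) within {-1..1})"

definition G_matrix :: "('n::finite \<Rightarrow> nat ^ 'n \<Rightarrow> real) \<Rightarrow> real ^ 'n \<Rightarrow> real ^ 'n ^ 'n" where
  "G_matrix b u = (\<chi> i j. of_bool (i = j) - B_partial b i j u / b i (axis i 1))"

text \<open>Since \<open>*\<close> and \<open>^\<close> are componentwise on vectors, matrix powers are iterated \<open>**\<close>.
  The zeroth power is excluded: it would make every \<open>1 \<times> 1\<close> matrix positively regular.\<close>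

definition positively_regular :: "real ^ 'n ^ 'n \<Rightarrow> bool" where
  "positively_regular A \<longleftrightarrow> (\<exists>N\<ge>1. \<forall>i j. 0 < (((\<lambda>X. A ** X) ^^ N) (mat 1)) $ i $ j)"

end

theory Submission
  imports Defs
begin

text \<open>The columns of \<open>Q\<close> have finite support, so the Feller minimal function \<open>F\<close>, the increasing limit
  of the semigroups \<open>exp (t Q\<^sub>N)\<close> of the truncations of \<open>Q\<close> to \<open>{i. \<bar>i\<bar> \<le> N}\<close>, solves the forward
  equation. A solution of the forward equation is a \<open>Q\<close>-function, hence dominates \<open>F\<close>; so uniqueness
  follows once \<open>F\<close> is honest.

  For honesty, \<open>\<phi>\<^sub>s(i) = s^\<bar>i\<bar>\<close> satisfies \<open>Q \<phi>\<^sub>s \<ge> - c (1 - s) \<partial>\<^sub>s \<phi>\<^sub>s - o(1)\<close> as \<open>s \<rightarrow> 1\<close>, where \<open>c\<close> bounds the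
  mean offspring numbers. Along the characteristic \<open>s(u) = 1 - \<epsilon> exp (- c u)\<close> the derivative of
  \<open>u \<mapsto> \<Sum>\<^sub>j F\<^sub>i\<^sub>j(u) s(u)^\<bar>j\<bar>\<close> is therefore at least \<open>- o(1)\<close> as \<open>\<epsilon> \<rightarrow> 0\<close>, while its value at \<open>0\<close>
  tends to \<open>1\<close>.\<close>

section \<open>Semigroups of finite matrices\<close>

text \<open>Matrices are functions on the whole type and products sum over \<open>E\<close> alone,
  so the index set can grow with the truncation level while the type stays fixed.\<close>

primrec mat_pow :: "'s set \<Rightarrow> ('s \<Rightarrow> 's \<Rightarrow> real) \<Rightarrow> nat \<Rightarrow> 's \<Rightarrow> 's \<Rightarrow> real" where
  "mat_pow E T 0 i j = of_bool (i = j)"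
| "mat_pow E T (Suc n) i j = (\<Sum>k\<in>E. mat_pow E T n i k * T k j)"

lemma mat_pow_add:
  assumes "finite E" "j \<in> E"
  shows "mat_pow E T (m + n) i j = (\<Sum>k\<in>E. mat_pow E T m i k * mat_pow E T n k j)"
  using assms(2)
proof (induction n arbitrary: j)
  case 0
  then show ?case using assms(1) by simp
next
  case (Suc n)
  have "mat_pow E T (m + Suc n) i j = (\<Sum>l\<in>E. (\<Sum>k\<in>E. mat_pow E T m i k * mat_pow E T n k l) * T l j)"
    using Suc.IH by simp
  also have "\<dots> = (\<Sum>k\<in>E. \<Sum>l\<in>E. mat_pow E T m i k * mat_pow E T n k l * T l j)"
    unfolding sum_distrib_right by (rule sum.swap)
  also have "\<dots> = (\<Sum>k\<in>E. mat_pow E T m i k * mat_pow E T (Suc n) k j)"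
    by (simp add: sum_distrib_left mult.assoc)
  finally show ?case .
qed

text \<open>Substochasticity passes to powers, so every entry of a power lies in [0,1] and the
  exponential series is dominated by that of \<open>exp \<bar>x\<bar>\<close>.\<close>

locale substochastic_matrix =
  fixes E :: "'s set" and T :: "'s \<Rightarrow> 's \<Rightarrow> real"
  assumes finite_E: "finite E"
    and nonneg: "\<And>i j. i \<in> E \<Longrightarrow> j \<in> E \<Longrightarrow> 0 \<le> T i j"
    and row_sum_le: "\<And>i. i \<in> E \<Longrightarrow> (\<Sum>j\<in>E. T i j) \<le> 1"
begin

lemma mat_pow_nonneg: "j \<in> E \<Longrightarrow> 0 \<le> mat_pow E T n i j"
  by (induction n arbitrary: j) (auto intro!: sum_nonneg mult_nonneg_nonneg nonneg)

lemma mat_pow_row_sum_le: "i \<in> E \<Longrightarrow> (\<Sum>j\<in>E. mat_pow E T n i j) \<le> 1"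
proof (induction n)
  case 0
  then show ?case using finite_E by simp
next
  case (Suc n)
  have "(\<Sum>j\<in>E. mat_pow E T (Suc n) i j) = (\<Sum>k\<in>E. mat_pow E T n i k * (\<Sum>j\<in>E. T k j))"
    by (simp add: sum_distrib_left) (rule sum.swap)
  also have "\<dots> \<le> (\<Sum>k\<in>E. mat_pow E T n i k * 1)"
    by (intro sum_mono mult_left_mono row_sum_le mat_pow_nonneg)
  finally show ?case using Suc by simp
qed

lemma mat_pow_le_1: "i \<in> E \<Longrightarrow> j \<in> E \<Longrightarrow> mat_pow E T n i j \<le> 1"
  using mat_pow_row_sum_le[of i n] member_le_sum[of j E "mat_pow E T n i"] finite_E mat_pow_nonneg
  by force

text \<open>Written as a power series in the scalar \<open>x\<close>, which admits termwise
  differentiation and Cauchy products entry by entry.\<close>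

definition mat_exp :: "real \<Rightarrow> 's \<Rightarrow> 's \<Rightarrow> real" where
  "mat_exp x i j = (\<Sum>n. mat_pow E T n i j / fact n * x ^ n)"

lemma norm_summable:
  assumes "i \<in> E" "j \<in> E"
  shows "summable (\<lambda>n. norm (mat_pow E T n i j / fact n * x ^ n))"
proof (rule summable_comparison_test')
  show "summable (\<lambda>n. inverse (fact n) *\<^sub>R \<bar>x\<bar> ^ n)"
    by (rule summable_exp_generic)
  show "norm (norm (mat_pow E T n i j / fact n * x ^ n)) \<le> inverse (fact n) *\<^sub>R \<bar>x\<bar> ^ n"
    for n
    using mat_pow_le_1[OF assms, of n] mat_pow_nonneg[OF assms(2), of n i]
    by (auto simp: abs_mult power_abs divide_simps intro!: mult_left_le_one_le)
qed

lemma summable_mat_exp: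
  "i \<in> E \<Longrightarrow> j \<in> E \<Longrightarrow> summable (\<lambda>n. mat_pow E T n i j / fact n * x ^ n)"
  by (rule summable_norm_cancel) (rule norm_summable)

lemma mat_exp_nonneg: "i \<in> E \<Longrightarrow> j \<in> E \<Longrightarrow> 0 \<le> x \<Longrightarrow> 0 \<le> mat_exp x i j"
  unfolding mat_exp_def
  by (intro suminf_nonneg summable_mat_exp) (auto intro!: divide_nonneg_pos mult_nonneg_nonneg mat_pow_nonneg)

lemma mat_exp_row_sum_le:
  assumes "i \<in> E" "0 \<le> x"
  shows "(\<Sum>j\<in>E. mat_exp x i j) \<le> exp x"
proof -
  have "(\<Sum>j\<in>E. mat_exp x i j) = (\<Sum>n. \<Sum>j\<in>E. mat_pow E T n i j / fact n * x ^ n)"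
    unfolding mat_exp_def by (rule suminf_sum[symmetric]) (rule summable_mat_exp[OF assms(1)])
  also have "\<dots> = (\<Sum>n. (\<Sum>j\<in>E. mat_pow E T n i j) / fact n * x ^ n)"
    by (simp add: sum_distrib_right sum_divide_distrib)
  also have "\<dots> \<le> (\<Sum>n. x ^ n /\<^sub>R fact n)"
  proof (rule suminf_le)
    fix n
    show "(\<Sum>j\<in>E. mat_pow E T n i j) / fact n * x ^ n \<le> x ^ n /\<^sub>R fact n"
      using mult_right_mono[OF mat_pow_row_sum_le[OF assms(1), of n], of "x ^ n / fact n"] assms(2)
      by (simp add: field_simps)
  next
    have "summable (\<lambda>n. \<Sum>j\<in>E. mat_pow E T n i j / fact n * x ^ n)"
      by (rule summable_sum) (rule summable_mat_exp[OF assms(1)])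
    then show "summable (\<lambda>n. (\<Sum>j\<in>E. mat_pow E T n i j) / fact n * x ^ n)"
      by (simp add: sum_distrib_right sum_divide_distrib)
  qed (rule summable_exp_generic)
  finally show ?thesis by (simp add: exp_def)
qed

lemma mat_exp_0: "mat_exp 0 i j = of_bool (i = j)"
  unfolding mat_exp_def by (subst powser_zero) simp

text \<open>Cauchy product of the two series: in degree n the matrix factors combine to the n-th
  power, and the scalar factors sum to \<open>(x + y) ^ n / fact n\<close> by the binomial
  theorem.\<close>

lemma mat_exp_add:
  assumes "i \<in> E" "j \<in> E"
  shows "mat_exp (x + y) i j = (\<Sum>k\<in>E. mat_exp x i k * mat_exp y k j)"
proof -
  let ?c = "\<lambda>k n. \<Sum>m\<le>n. (mat_pow E T m i k / fact m * x ^ m)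
                    * (mat_pow E T (n - m) k j / fact (n - m) * y ^ (n - m))"
  have binom: "(x + y) ^ n / fact n = (\<Sum>m\<le>n. (x ^ m / fact m) * (y ^ (n - m) / fact (n - m)))" for n
    by (simp add: binomial_ring sum_divide_distrib binomial_fact field_simps)
  have "?c k sums (mat_exp x i k * mat_exp y k j)" if "k \<in> E" for k
    unfolding mat_exp_def
    using Cauchy_product_sums[OF norm_summable[OF assms(1) that, of x] norm_summable[OF that assms(2), of y]] .
  then have "(\<lambda>n. \<Sum>k\<in>E. ?c k n) sums (\<Sum>k\<in>E. mat_exp x i k * mat_exp y k j)"
    by (rule sums_sum)
  moreover have "(\<Sum>k\<in>E. ?c k n) = mat_pow E T n i j / fact n * (x + y) ^ n" for n
  proof -
    have "(\<Sum>k\<in>E. ?c k n) = (\<Sum>m\<le>n. \<Sum>k\<in>E. (mat_pow E T m i k / fact m * x ^ m)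
                    * (mat_pow E T (n - m) k j / fact (n - m) * y ^ (n - m)))"
      by (rule sum.swap)
    also have "\<dots> = (\<Sum>m\<le>n. (\<Sum>k\<in>E. mat_pow E T m i k * mat_pow E T (n - m) k j)
                    * ((x ^ m / fact m) * (y ^ (n - m) / fact (n - m))))"
      by (simp add: sum_distrib_left sum_distrib_right sum_divide_distrib mult_ac)
    also have "\<dots> = (\<Sum>m\<le>n. mat_pow E T n i j
                    * ((x ^ m / fact m) * (y ^ (n - m) / fact (n - m))))"
      by (intro sum.cong refl) (simp add: mat_pow_add[OF finite_E assms(2), symmetric])
    also have "\<dots> = mat_pow E T n i j * ((x + y) ^ n / fact n)"
      by (simp add: binom sum_distrib_left)
    finally show ?thesis by simp
  qed
  ultimately show ?thesis by (simp add: mat_exp_def sums_iff)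
qed

text \<open>Termwise differentiation shifts the index by one. The additional factor of the power is
  split off on the right, which gives the forward form.\<close>

lemma has_real_derivative_mat_exp:
  assumes "i \<in> E" "j \<in> E"
  shows "((\<lambda>x. mat_exp x i j) has_real_derivative (\<Sum>k\<in>E. mat_exp x i k * T k j)) (at x)"
proof -
  have "((\<lambda>x. mat_exp x i j) has_real_derivative
           (\<Sum>n. diffs (\<lambda>n. mat_pow E T n i j / fact n) n * x ^ n)) (at x)"
    unfolding mat_exp_def
    by (rule termdiffs_strong_converges_everywhere) (rule summable_mat_exp[OF assms])
  moreover have "(\<Sum>n. diffs (\<lambda>n. mat_pow E T n i j / fact n) n * x ^ n)
      = (\<Sum>n. \<Sum>k\<in>E. (mat_pow E T n i k / fact n * x ^ n) * T k j)"
  proof (rule suminf_cong)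
    fix n
    have "diffs (\<lambda>n. mat_pow E T n i j / fact n) n = mat_pow E T (Suc n) i j / fact n"
      by (simp add: diffs_def del: of_nat_Suc mat_pow.simps)
    then show "diffs (\<lambda>n. mat_pow E T n i j / fact n) n * x ^ n =
        (\<Sum>k\<in>E. (mat_pow E T n i k / fact n * x ^ n) * T k j)"
      by (simp add: sum_distrib_left sum_distrib_right sum_divide_distrib mult_ac)
  qed
  moreover have "\<dots> = (\<Sum>k\<in>E. \<Sum>n. (mat_pow E T n i k / fact n * x ^ n) * T k j)"
    by (intro suminf_sum summable_mult2 summable_mat_exp assms)
  moreover have "\<dots> = (\<Sum>k\<in>E. mat_exp x i k * T k j)"
    unfolding mat_exp_def by (intro sum.cong refl suminf_mult2[symmetric] summable_mat_exp assms)
  ultimately show ?thesis by simp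
qed

end

text \<open>Uniformization: \<open>exp (t Q) = exp (- c t) exp (c t T)\<close> with \<open>T = I + Q / c\<close>, and \<open>T\<close> is
  nonnegative once \<open>c\<close> exceeds all the diagonal rates.\<close>

lemma finite_semigroup_exists:
  fixes Q :: "'s \<Rightarrow> 's \<Rightarrow> real"
  assumes fin: "finite E"
    and off: "\<And>i j. i \<in> E \<Longrightarrow> j \<in> E \<Longrightarrow> i \<noteq> j \<Longrightarrow> 0 \<le> Q i j"
    and row: "\<And>i. i \<in> E \<Longrightarrow> (\<Sum>j\<in>E. Q i j) \<le> 0"
  shows "\<exists>D. (\<forall>t\<ge>0. \<forall>i\<in>E. \<forall>j\<in>E. 0 \<le> D t i j) \<and>
      (\<forall>t\<ge>0. \<forall>i\<in>E. (\<Sum>j\<in>E. D t i j) \<le> 1) \<and>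
      (\<forall>i\<in>E. \<forall>j\<in>E. D 0 i j = of_bool (i = j)) \<and>
      (\<forall>s t. \<forall>i\<in>E. \<forall>j\<in>E. D (s + t) i j = (\<Sum>k\<in>E. D s i k * D t k j)) \<and>
      (\<forall>t. \<forall>i\<in>E. \<forall>j\<in>E. ((\<lambda>t. D t i j) has_real_derivative (\<Sum>k\<in>E. D t i k * Q k j)) (at t))"
proof -
  \<comment> \<open>The sum dominates each single diagonal rate; the summand 1 keeps
    \<open>c\<close> positive even when the sum vanishes.\<close>
  define c where "c = 1 + (\<Sum>i\<in>E. \<bar>Q i i\<bar>)"
  define T where "T = (\<lambda>i j. of_bool (i = j) + Q i j / c)"
  have c: "c > 0" "\<bar>Q i i\<bar> \<le> c" if "i \<in> E" for i
    using member_le_sum[OF that, of "\<lambda>i. \<bar>Q i i\<bar>"] fin by (auto simp: c_def intro!: add_pos_nonneg sum_nonneg)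
  have c0: "c > 0" unfolding c_def by (intro add_pos_nonneg sum_nonneg) auto
  interpret substochastic_matrix E T
  proof
    show "finite E" by fact
    show "0 \<le> T i j" if "i \<in> E" "j \<in> E" for i j
      using c[OF that(1)] off[OF that] by (auto simp: T_def field_simps)
    show "(\<Sum>j\<in>E. T i j) \<le> 1" if "i \<in> E" for i
      using row[OF that] c0 fin that
      by (simp add: T_def sum.distrib sum_divide_distrib[symmetric] divide_nonpos_pos)
  qed
  define D where "D = (\<lambda>t i j. exp (- c * t) * mat_exp (c * t) i j)"
  have "((\<lambda>t. D t i j) has_real_derivative (\<Sum>k\<in>E. D t i k * Q k j)) (at t)"
    if "i \<in> E" "j \<in> E" for t i j
  proof -
    have chain: "((\<lambda>t. mat_exp (c * t) i j) has_real_derivative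
        (\<Sum>k\<in>E. mat_exp (c * t) i k * T k j) * c) (at t)"
      by (rule DERIV_chain2[OF has_real_derivative_mat_exp[OF that]]) (auto intro!: derivative_eq_intros)
    have "((\<lambda>t. D t i j) has_real_derivative
        exp (- c * t) * (- c) * mat_exp (c * t) i j +
        exp (- c * t) * ((\<Sum>k\<in>E. mat_exp (c * t) i k * T k j) * c)) (at t)"
      unfolding D_def by (rule derivative_eq_intros chain refl | simp add: algebra_simps)+
    \<comment> \<open>The identity part of \<open>T\<close> yields \<open>c * mat_exp\<close>, which
      cancels the derivative of the factor \<open>exp (- c * t)\<close>; only the part with
      \<open>Q\<close> is left.\<close>
    moreover have "(\<Sum>k\<in>E. mat_exp (c * t) i k * T k j) * c
        = c * mat_exp (c * t) i j + (\<Sum>k\<in>E. mat_exp (c * t) i k * Q k j)"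
      using c0 fin that
      by (simp add: T_def distrib_left sum.distrib algebra_simps sum_distrib_left)
    ultimately have "((\<lambda>t. D t i j) has_real_derivative
        exp (- c * t) * (\<Sum>k\<in>E. mat_exp (c * t) i k * Q k j)) (at t)"
      by (simp add: distrib_left)
    then show ?thesis
      by (simp add: D_def sum_distrib_left mult.assoc)
  qed
  moreover have "D (s + t) i j = (\<Sum>k\<in>E. D s i k * D t k j)" if "i \<in> E" "j \<in> E" for s t i j
    by (simp add: D_def distrib_left mat_exp_add[OF that] mult_exp_exp[symmetric] exp_diff exp_minus field_simps
        sum_distrib_left sum_divide_distrib)
  moreover have "(\<Sum>j\<in>E. D t i j) \<le> 1" if "t \<ge> 0" "i \<in> E" for t i
  proof -
    have "(\<Sum>j\<in>E. D t i j) \<le> exp (- c * t) * exp (c * t)"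
      unfolding D_def sum_distrib_left[symmetric]
      using that c0 by (intro mult_left_mono mat_exp_row_sum_le) auto
    then show ?thesis by (simp add: mult_exp_exp)
  qed
  ultimately show ?thesis
    using c0 by (intro exI[of _ D]) (auto simp: D_def mat_exp_0 mat_exp_nonneg)
qed

text \<open>Writing \<open>t = m h\<close>, one step of length \<open>h\<close> increases the largest entry of \<open>D - P\<close> by at most
  \<open>card E * \<bar>D h - P h\<bar> = o(h)\<close>.\<close>

lemma semigroup_le_supersemigroup:
  fixes D P :: "real \<Rightarrow> 's \<Rightarrow> 's \<Rightarrow> real"
  assumes fin: "finite E"
    and D_nonneg: "\<And>t i j. 0 \<le> t \<Longrightarrow> i \<in> E \<Longrightarrow> j \<in> E \<Longrightarrow> 0 \<le> D t i j"
    and D_le: "\<And>t i j. 0 \<le> t \<Longrightarrow> i \<in> E \<Longrightarrow> j \<in> E \<Longrightarrow> D t i j \<le> 1"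
    and D_0: "\<And>i j. i \<in> E \<Longrightarrow> j \<in> E \<Longrightarrow> D 0 i j = of_bool (i = j)"
    and D_add: "\<And>s t i j. 0 \<le> s \<Longrightarrow> 0 \<le> t \<Longrightarrow> i \<in> E \<Longrightarrow> j \<in> E \<Longrightarrow>
                  D (s + t) i j = (\<Sum>k\<in>E. D s i k * D t k j)"
    and D_deriv: "\<And>i j. i \<in> E \<Longrightarrow> j \<in> E \<Longrightarrow>
                  ((\<lambda>t. D t i j) has_real_derivative Q i j) (at 0 within {0..})"
    and P_nonneg: "\<And>t i j. 0 \<le> t \<Longrightarrow> i \<in> E \<Longrightarrow> j \<in> E \<Longrightarrow> 0 \<le> P t i j"
    and P_le: "\<And>t i. 0 \<le> t \<Longrightarrow> i \<in> E \<Longrightarrow> (\<Sum>j\<in>E. P t i j) \<le> 1"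
    and P_0: "\<And>i j. i \<in> E \<Longrightarrow> j \<in> E \<Longrightarrow> P 0 i j = of_bool (i = j)"
    and P_add: "\<And>s t i j. 0 \<le> s \<Longrightarrow> 0 \<le> t \<Longrightarrow> i \<in> E \<Longrightarrow> j \<in> E \<Longrightarrow>
                  (\<Sum>k\<in>E. P s i k * P t k j) \<le> P (s + t) i j"
    and P_deriv: "\<And>i j. i \<in> E \<Longrightarrow> j \<in> E \<Longrightarrow>
                  ((\<lambda>t. P t i j) has_real_derivative Q i j) (at 0 within {0..})"
    and t: "0 \<le> t" and i: "i \<in> E" and j: "j \<in> E"
  shows "D t i j \<le> P t i j"
proof (cases "t = 0")
  case True
  then show ?thesis using D_0 P_0 i j by simp
next
  case False
  then have t: "t > 0" using t by simp
  have "D t i j \<le> P t i j + e" if e: "e > 0" for e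
  proof -
    \<comment> \<open>Chosen so that the errors \<open>card E * (\<eta> * h)\<close> of all steps,
      of total length \<open>t\<close>, add up to \<open>e\<close>.\<close>
    define \<eta> where "\<eta> = e / (t * card E)"
    have "card E > 0" using i fin by (auto simp: card_gt_0_iff)
    then have \<eta>: "\<eta> > 0" "t * (card E * \<eta>) = e" using t e by (auto simp: \<eta>_def)
    \<comment> \<open>\<open>D\<close> and \<open>P\<close> agree at 0 and have the same derivative
      there, so their difference is o(h).\<close>
    have "eventually (\<lambda>h. \<bar>D h k l - P h k l\<bar> \<le> \<eta> * h) (at_right 0)" if "k \<in> E" "l \<in> E" for k l
    proof -
      have "((\<lambda>h. D h k l - P h k l) has_real_derivative 0) (at 0 within {0..})"
        using DERIV_diff[OF D_deriv[OF that] P_deriv[OF that]] by simp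
      then have "((\<lambda>h. (D h k l - P h k l) / h) \<longlongrightarrow> 0) (at 0 within {0..})"
        using D_0[OF that] P_0[OF that] by (simp add: has_field_derivative_iff)
      then have "((\<lambda>h. (D h k l - P h k l) / h) \<longlongrightarrow> 0) (at_right 0)"
        by (rule tendsto_within_subset) auto
      from tendstoD[OF this \<eta>(1)] eventually_at_right_less[of 0]
      show ?thesis
        by eventually_elim (auto simp: dist_real_def field_simps)
    qed
    then have "eventually (\<lambda>h. \<forall>k\<in>E. \<forall>l\<in>E. \<bar>D h k l - P h k l\<bar> \<le> \<eta> * h) (at_right 0)"
      using fin by (intro eventually_ball_finite ballI)
    then obtain \<delta> where \<delta>: "\<delta> > 0"
      "\<And>h k l. 0 < h \<Longrightarrow> h < \<delta> \<Longrightarrow> k \<in> E \<Longrightarrow> l \<in> E \<Longrightarrow> \<bar>D h k l - P h k l\<bar> \<le> \<eta> * h"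
      unfolding eventually_at_right_field by auto
    obtain m :: nat where m: "t / \<delta> < m" using reals_Archimedean2 by blast
    have m0: "m > 0" using m t \<delta>(1) by (cases m) (auto simp: field_simps not_less)
    define h where "h = t / m"
    have h: "0 < h" "h < \<delta>" "m * h = t"
      using m m0 t \<delta>(1) by (auto simp: h_def field_simps)
    have step: "D (n * h) k l \<le> P (n * h) k l + n * (card E * (\<eta> * h))"
      if "k \<in> E" "l \<in> E" for n :: nat and k l
      using that(1)
    proof (induction n arbitrary: k)
      case 0
      then show ?case using D_0 P_0 that(2) by simp
    next
      case (Suc n)
      have nh: "0 \<le> n * h" "(1 + real n) * h = h + n * h" using h by (auto simp: algebra_simps)
      have "D (Suc n * h) k l = (\<Sum>r\<in>E. D h k r * D (n * h) r l)"
        using D_add[OF _ nh(1) Suc.prems that(2), of h] h by (simp add: nh)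
      also have "\<dots> \<le> (\<Sum>r\<in>E. P h k r * P (n * h) r l + P h k r * (n * (card E * (\<eta> * h))) + \<eta> * h)"
      proof (rule sum_mono)
        fix r assume r: "r \<in> E"
        \<comment> \<open>Split \<open>D h = (D h - P h) + P h\<close>. The first part costs at most
          \<open>\<eta> * h\<close> because entries of \<open>D\<close> are at most 1; the second
          uses the induction hypothesis, and the row sums of \<open>P\<close> being at most 1 keep
          the accumulated error from being amplified.\<close>
        have "(D h k r - P h k r) * D (n * h) r l \<le> (\<eta> * h) * 1"
          using \<delta>(2)[OF h(1,2) Suc.prems r] D_nonneg[OF nh(1) r that(2)] D_le[OF nh(1) r that(2)] \<eta>(1) h(1)
          by (intro mult_mono) auto
        moreover have "P h k r * D (n * h) r l \<le> P h k r * (P (n * h) r l + n * (card E * (\<eta> * h)))"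
          using Suc.IH[OF r] P_nonneg[OF _ Suc.prems r] h(1) by (intro mult_left_mono) auto
        ultimately show "D h k r * D (n * h) r l \<le>
            P h k r * P (n * h) r l + P h k r * (n * (card E * (\<eta> * h))) + \<eta> * h"
          by (simp add: algebra_simps)
      qed
      also have "\<dots> = (\<Sum>r\<in>E. P h k r * P (n * h) r l)
          + (\<Sum>r\<in>E. P h k r) * (n * (card E * (\<eta> * h))) + card E * (\<eta> * h)"
        by (simp add: sum.distrib sum_distrib_right)
      also have "\<dots> \<le> P (h + n * h) k l + 1 * (n * (card E * (\<eta> * h))) + card E * (\<eta> * h)"
        using h(1) \<eta>(1) nh(1)
        by (intro add_mono mult_right_mono P_add P_le Suc.prems that(2)) auto
      finally show ?case by (simp add: algebra_simps)
    qed
    have "m * (card E * (\<eta> * h)) = e"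
      using \<eta>(2) h(3) by (metis mult.assoc mult.commute)
    then show ?thesis using step[OF i j, of m] h(3) by simp
  qed
  then show ?thesis by (rule field_le_epsilon)
qed

section \<open>The minimal semigroup of a column-finite matrix\<close>

text \<open>\<open>row_sum_nonpos\<close> says that the off-diagonal rates of a row sum to at most
  the exit rate, without infinite sums. \<open>finite_column\<close> makes the sums in the forward
  equation finite.\<close>

locale column_finite_qmatrix =
  fixes Q :: "'s \<Rightarrow> 's \<Rightarrow> real" and E :: "nat \<Rightarrow> 's set"
  assumes off_diag_nonneg: "\<And>i j. i \<noteq> j \<Longrightarrow> 0 \<le> Q i j"
    and row_sum_nonpos: "\<And>K i. finite K \<Longrightarrow> i \<in> K \<Longrightarrow> (\<Sum>j\<in>K. Q i j) \<le> 0"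
    and finite_column: "\<And>j. finite {i. Q i j \<noteq> 0}"
    and finite_E: "\<And>n. finite (E n)"
    and mono_E: "\<And>m n. m \<le> n \<Longrightarrow> E m \<subseteq> E n"
    and E_exhausts: "\<And>i. \<exists>n. i \<in> E n"
begin

lemma eventually_subset_E:
  assumes "finite K"
  shows "eventually (\<lambda>n. K \<subseteq> E n) sequentially"
proof -
  have "eventually (\<lambda>n. i \<in> E n) sequentially" for i
    using E_exhausts[of i] mono_E unfolding eventually_sequentially by blast
  then have "eventually (\<lambda>n. \<forall>i\<in>K. i \<in> E n) sequentially"
    using assms by (intro eventually_ball_finite) auto
  then show ?thesis by (simp add: subset_eq)
qed

section \<open>Truncations to the finite sets \<open>E n\<close>\<close>

definition finite_semigroup :: "nat \<Rightarrow> real \<Rightarrow> 's \<Rightarrow> 's \<Rightarrow> real" where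
  "finite_semigroup n = (SOME D. (\<forall>t\<ge>0. \<forall>i\<in>E n. \<forall>j\<in>E n. 0 \<le> D t i j) \<and>
      (\<forall>t\<ge>0. \<forall>i\<in>E n. (\<Sum>j\<in>E n. D t i j) \<le> 1) \<and>
      (\<forall>i\<in>E n. \<forall>j\<in>E n. D 0 i j = of_bool (i = j)) \<and>
      (\<forall>s t. \<forall>i\<in>E n. \<forall>j\<in>E n. D (s + t) i j = (\<Sum>k\<in>E n. D s i k * D t k j)) \<and>
      (\<forall>t. \<forall>i\<in>E n. \<forall>j\<in>E n.
         ((\<lambda>t. D t i j) has_real_derivative (\<Sum>k\<in>E n. D t i k * Q k j)) (at t)))"

text \<open>Extension by zero puts all levels on one state space, where they can be compared; at
  time 0 it is the identity only on \<open>E n\<close>.\<close>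

definition trunc :: "nat \<Rightarrow> real \<Rightarrow> 's \<Rightarrow> 's \<Rightarrow> real" where
  "trunc n t i j = (if i \<in> E n \<and> j \<in> E n then finite_semigroup n t i j else 0)"

lemma
  shows trunc_nonneg: "0 \<le> t \<Longrightarrow> 0 \<le> trunc n t i j"
    and trunc_row_sum_le_E: "0 \<le> t \<Longrightarrow> (\<Sum>j\<in>E n. trunc n t i j) \<le> 1"
    and trunc_0: "i \<in> E n \<Longrightarrow> j \<in> E n \<Longrightarrow> trunc n 0 i j = of_bool (i = j)"
    and trunc_add: "trunc n (s + t) i j = (\<Sum>k\<in>E n. trunc n s i k * trunc n t k j)"
    and trunc_deriv: "j \<in> E n \<Longrightarrow>
      ((\<lambda>t. trunc n t i j) has_real_derivative (\<Sum>k\<in>E n. trunc n t i k * Q k j)) (at t)"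
proof -
  have ex: "\<exists>D. (\<forall>t\<ge>0. \<forall>i\<in>E n. \<forall>j\<in>E n. 0 \<le> D t i j) \<and>
      (\<forall>t\<ge>0. \<forall>i\<in>E n. (\<Sum>j\<in>E n. D t i j) \<le> 1) \<and>
      (\<forall>i\<in>E n. \<forall>j\<in>E n. D 0 i j = of_bool (i = j)) \<and>
      (\<forall>s t. \<forall>i\<in>E n. \<forall>j\<in>E n. D (s + t) i j = (\<Sum>k\<in>E n. D s i k * D t k j)) \<and>
      (\<forall>t. \<forall>i\<in>E n. \<forall>j\<in>E n.
         ((\<lambda>t. D t i j) has_real_derivative (\<Sum>k\<in>E n. D t i k * Q k j)) (at t))"
    by (rule finite_semigroup_exists)
       (auto intro: finite_E off_diag_nonneg row_sum_nonpos)
  note D = someI_ex[OF ex, folded finite_semigroup_def]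
  show "0 \<le> trunc n t i j" if "0 \<le> t"
    using D that by (simp add: trunc_def)
  show "(\<Sum>j\<in>E n. trunc n t i j) \<le> 1" if "0 \<le> t"
    using D that by (cases "i \<in> E n") (simp_all add: trunc_def cong: sum.cong)
  show "trunc n 0 i j = of_bool (i = j)" if "i \<in> E n" "j \<in> E n"
    using D that by (simp add: trunc_def)
  show "trunc n (s + t) i j = (\<Sum>k\<in>E n. trunc n s i k * trunc n t k j)"
    using D by (cases "i \<in> E n"; cases "j \<in> E n") (simp_all add: trunc_def cong: sum.cong)
  show "((\<lambda>t. trunc n t i j) has_real_derivative (\<Sum>k\<in>E n. trunc n t i k * Q k j)) (at t)"
    if "j \<in> E n"
    using D that by (cases "i \<in> E n") (simp_all add: trunc_def cong: sum.cong)
qed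

lemma trunc_eq_0: "j \<notin> E n \<Longrightarrow> trunc n t i j = 0"
  by (simp add: trunc_def)

lemma trunc_row_sum_le:
  assumes "0 \<le> t" "finite K"
  shows "(\<Sum>j\<in>K. trunc n t i j) \<le> 1"
proof -
  have "(\<Sum>j\<in>K. trunc n t i j) \<le> (\<Sum>j\<in>K \<union> E n. trunc n t i j)"
    using assms finite_E by (intro sum_mono2) (auto intro: trunc_nonneg)
  also have "\<dots> = (\<Sum>j\<in>E n. trunc n t i j)"
    using assms finite_E by (intro sum.mono_neutral_right) (auto simp: trunc_eq_0)
  also have "\<dots> \<le> 1" by (rule trunc_row_sum_le_E) fact
  finally show ?thesis .
qed

lemma trunc_le_1: "0 \<le> t \<Longrightarrow> trunc n t i j \<le> 1"
  using trunc_row_sum_le[of t "{j}" n i] by simp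

lemma trunc_deriv_0:
  assumes "i \<in> E n" "j \<in> E n"
  shows "((\<lambda>t. trunc n t i j) has_real_derivative Q i j) (at 0 within S)"
proof -
  have "(\<Sum>k\<in>E n. trunc n 0 i k * Q k j) = (\<Sum>k\<in>E n. if k = i then Q k j else 0)"
    using assms by (intro sum.cong refl) (simp add: trunc_0)
  then have "(\<Sum>k\<in>E n. trunc n 0 i k * Q k j) = Q i j"
    using assms finite_E by simp
  then show ?thesis
    using trunc_deriv[OF assms(2), of i 0] by (simp add: has_field_derivative_at_within)
qed

text \<open>The semigroup property of \<open>P\<close> is demanded only as an inequality, since
  summing over \<open>E n\<close> omits intermediate states outside. This fits both larger
  truncations and arbitrary Q-functions.\<close>

lemma trunc_le_supersemigroup:
  assumes nonneg: "\<And>t i j. 0 \<le> t \<Longrightarrow> 0 \<le> P t i j"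
    and row: "\<And>t i. 0 \<le> t \<Longrightarrow> (\<Sum>j\<in>E n. P t i j) \<le> 1"
    and zero: "\<And>i j. i \<in> E n \<Longrightarrow> j \<in> E n \<Longrightarrow> P 0 i j = of_bool (i = j)"
    and add: "\<And>s t i j. 0 \<le> s \<Longrightarrow> 0 \<le> t \<Longrightarrow> (\<Sum>k\<in>E n. P s i k * P t k j) \<le> P (s + t) i j"
    and deriv: "\<And>i j. i \<in> E n \<Longrightarrow> j \<in> E n \<Longrightarrow>
                  ((\<lambda>t. P t i j) has_real_derivative Q i j) (at 0 within {0..})"
    and t: "0 \<le> t"
  shows "trunc n t i j \<le> P t i j"
proof (cases "i \<in> E n \<and> j \<in> E n")
  case True
  show ?thesis
    by (rule semigroup_le_supersemigroup[where E = "E n" and Q = Q])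
       (use True finite_E trunc_nonneg trunc_le_1 trunc_0 trunc_add trunc_deriv_0 assms in auto)
next
  case False
  then show ?thesis using nonneg t by (auto simp: trunc_def)
qed

lemma trunc_mono:
  assumes "m \<le> n" "0 \<le> t"
  shows "trunc m t i j \<le> trunc n t i j"
proof (rule trunc_le_supersemigroup)
  fix s t :: real and i j
  assume st: "0 \<le> s" "0 \<le> t"
  show "0 \<le> trunc n t i j" by (rule trunc_nonneg) fact
  show "(\<Sum>j\<in>E m. trunc n t i j) \<le> 1" by (rule trunc_row_sum_le[OF st(2) finite_E])
  show "(\<Sum>k\<in>E m. trunc n s i k * trunc n t k j) \<le> trunc n (s + t) i j"
    unfolding trunc_add using mono_E[OF assms(1)] finite_E
    by (intro sum_mono2) (auto intro: mult_nonneg_nonneg trunc_nonneg st)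
qed (use subsetD[OF mono_E[OF assms(1)]] assms(2) in \<open>simp_all add: trunc_0 trunc_deriv_0\<close>)

section \<open>The monotone limit of the truncations\<close>

definition minimal :: "real \<Rightarrow> 's \<Rightarrow> 's \<Rightarrow> real" where
  "minimal t i j = lim (\<lambda>n. trunc n t i j)"

lemma LIMSEQ_trunc:
  assumes "0 \<le> t"
  shows "(\<lambda>n. trunc n t i j) \<longlonglongrightarrow> minimal t i j"
proof -
  have "incseq (\<lambda>n. trunc n t i j)"
    unfolding incseq_def using trunc_mono assms by blast
  then have "convergent (\<lambda>n. trunc n t i j)"
    using trunc_le_1[OF assms] incseq_convergent unfolding convergent_def by metis
  then show ?thesis by (simp add: minimal_def convergent_LIMSEQ_iff)
qed

lemma trunc_le_minimal: "0 \<le> t \<Longrightarrow> trunc n t i j \<le> minimal t i j"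
  by (rule incseq_le[OF _ LIMSEQ_trunc]) (auto simp: incseq_def trunc_mono)

lemma minimal_nonneg: "0 \<le> t \<Longrightarrow> 0 \<le> minimal t i j"
  using trunc_nonneg trunc_le_minimal order_trans by blast

lemma minimal_row_sum_le:
  "0 \<le> t \<Longrightarrow> finite K \<Longrightarrow> (\<Sum>j\<in>K. minimal t i j) \<le> 1"
  by (rule LIMSEQ_le_const2[OF tendsto_sum[OF LIMSEQ_trunc]]) (auto intro: trunc_row_sum_le)

lemma minimal_summable: "0 \<le> t \<Longrightarrow> minimal t i summable_on K"
  by (rule nonneg_bdd_above_summable_on)
     (auto simp: bdd_above_def intro!: minimal_nonneg exI[of _ 1] minimal_row_sum_le)

lemma minimal_0: "minimal 0 i j = of_bool (i = j)"
proof (rule LIMSEQ_unique[OF LIMSEQ_trunc])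
  show "(\<lambda>n. trunc n 0 i j) \<longlonglongrightarrow> of_bool (i = j)"
    using eventually_subset_E[of "{i, j}"]
    by (intro tendsto_eventually) (auto simp: trunc_0 elim: eventually_mono)
qed simp

lemma minimal_add:
  assumes "0 \<le> s" "0 \<le> t"
  shows "((\<lambda>k. minimal s i k * minimal t k j) has_sum minimal (s + t) i j) UNIV"
proof -
  let ?f = "\<lambda>k. minimal s i k * minimal t k j"
  have nonneg: "0 \<le> ?f k" for k
    using assms by (intro mult_nonneg_nonneg minimal_nonneg)
  \<comment> \<open>For a fixed finite \<open>K\<close>, once \<open>K \<subseteq> E n\<close> the
    sum over \<open>K\<close> is part of the semigroup identity of the truncation; then n tends to
    infinity.\<close>
  have upper: "sum ?f K \<le> minimal (s + t) i j" if "finite K" for K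
  proof (rule LIMSEQ_le)
    show "(\<lambda>n. \<Sum>k\<in>K. trunc n s i k * trunc n t k j) \<longlonglongrightarrow> sum ?f K"
      using assms by (intro tendsto_sum tendsto_mult LIMSEQ_trunc)
    show "(\<lambda>n. trunc n (s + t) i j) \<longlonglongrightarrow> minimal (s + t) i j"
      using assms by (intro LIMSEQ_trunc) auto
    have "(\<Sum>k\<in>K. trunc n s i k * trunc n t k j) \<le> trunc n (s + t) i j" if "K \<subseteq> E n" for n
      unfolding trunc_add using that finite_E assms
      by (intro sum_mono2) (auto intro: mult_nonneg_nonneg trunc_nonneg)
    then show "\<exists>N. \<forall>n\<ge>N. (\<Sum>k\<in>K. trunc n s i k * trunc n t k j) \<le> trunc n (s + t) i j"
      using eventually_subset_E[OF that] by (auto simp: eventually_sequentially)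
  qed
  then have summable: "?f summable_on UNIV"
    by (intro nonneg_bdd_above_summable_on) (auto simp: bdd_above_def nonneg)
  \<comment> \<open>Conversely, in the identity for each truncation both factors are replaced by
    their larger limits before n tends to infinity.\<close>
  have "minimal (s + t) i j \<le> infsum ?f UNIV"
  proof (rule LIMSEQ_le_const2[OF LIMSEQ_trunc])
    have "trunc n (s + t) i j \<le> infsum ?f UNIV" for n
    proof -
      have "trunc n (s + t) i j \<le> sum ?f (E n)"
        unfolding trunc_add using assms
        by (intro sum_mono mult_mono trunc_le_minimal trunc_nonneg minimal_nonneg)
      also have "\<dots> \<le> infsum ?f UNIV"
        using nonneg by (intro finite_sum_le_infsum summable finite_E) auto
      finally show ?thesis .
    qed
    then show "\<exists>N. \<forall>n\<ge>N. trunc n (s + t) i j \<le> infsum ?f UNIV" by blast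
  qed (use assms in auto)
  moreover have "infsum ?f UNIV \<le> minimal (s + t) i j"
    by (rule infsum_le_finite_sums[OF summable upper])
  ultimately show ?thesis using summable by (metis has_sum_infsum order_antisym)
qed

section \<open>The forward equation for the limit\<close>

definition column_support :: "'s \<Rightarrow> 's set" where
  "column_support j = {i. Q i j \<noteq> 0}"

lemma finite_column_support: "finite (column_support j)"
  by (simp add: column_support_def finite_column)

lemma trunc_deriv_column:
  assumes "j \<in> E n" "column_support j \<subseteq> E n"
  shows "((\<lambda>t. trunc n t i j) has_real_derivative (\<Sum>k\<in>column_support j. trunc n t i k * Q k j)) (at t)"
proof -
  have "(\<Sum>k\<in>E n. trunc n t i k * Q k j) = (\<Sum>k\<in>column_support j. trunc n t i k * Q k j)"
    using assms finite_E by (intro sum.mono_neutral_right) (auto simp: column_support_def)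
  then show ?thesis using trunc_deriv[OF assms(1), of i t] by simp
qed

lemma abs_column_sum_le:
  assumes "\<And>k. \<bar>p k\<bar> \<le> 1"
  shows "\<bar>\<Sum>k\<in>column_support j. p k * Q k j\<bar> \<le> (\<Sum>k\<in>column_support j. \<bar>Q k j\<bar>)"
  by (rule order_trans[OF sum_abs sum_mono])
     (simp add: abs_mult assms mult_left_le_one_le)

text \<open>Once \<open>E n\<close> contains \<open>j\<close> and its column support, the derivative
  of the truncation is a finite column sum with weights in [0,1]. The resulting Lipschitz constant
  does not depend on n and survives the limit.\<close>

lemma minimal_lipschitz:
  assumes "0 \<le> s" "s \<le> t"
  shows "\<bar>minimal t i j - minimal s i j\<bar> \<le> (\<Sum>k\<in>column_support j. \<bar>Q k j\<bar>) * (t - s)"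
proof (rule LIMSEQ_le_const2)
  show "(\<lambda>n. \<bar>trunc n t i j - trunc n s i j\<bar>) \<longlonglongrightarrow> \<bar>minimal t i j - minimal s i j\<bar>"
    using assms by (intro tendsto_rabs tendsto_diff LIMSEQ_trunc) auto
  have "\<bar>trunc n t i j - trunc n s i j\<bar> \<le> (\<Sum>k\<in>column_support j. \<bar>Q k j\<bar>) * (t - s)"
    if "insert j (column_support j) \<subseteq> E n" for n
  proof -
    have "norm (trunc n t i j - trunc n s i j) \<le> (\<Sum>k\<in>column_support j. \<bar>Q k j\<bar>) * norm (t - s)"
    proof (rule field_differentiable_bound[of "{s..t}"])
      fix u assume u: "u \<in> {s..t}"
      show "((\<lambda>t. trunc n t i j) has_field_derivative
              (\<Sum>k\<in>column_support j. trunc n u i k * Q k j)) (at u within {s..t})"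
        using trunc_deriv_column[of j n i u] that by (auto intro: has_field_derivative_at_within)
      show "norm (\<Sum>k\<in>column_support j. trunc n u i k * Q k j) \<le> (\<Sum>k\<in>column_support j. \<bar>Q k j\<bar>)"
        using u assms by (simp add: abs_column_sum_le trunc_nonneg trunc_le_1 abs_of_nonneg)
    qed (use assms in auto)
    then show ?thesis using assms by simp
  qed
  then have "eventually (\<lambda>n. \<bar>trunc n t i j - trunc n s i j\<bar>
                \<le> (\<Sum>k\<in>column_support j. \<bar>Q k j\<bar>) * (t - s)) sequentially"
    by (rule eventually_mono[OF eventually_subset_E[of "insert j (column_support j)"], rotated])
       (simp_all add: finite_column_support)
  then show "\<exists>N. \<forall>n\<ge>N. \<bar>trunc n t i j - trunc n s i j\<bar> \<le> (\<Sum>k\<in>column_support j. \<bar>Q k j\<bar>) * (t - s)"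
    by (simp add: eventually_sequentially)
qed

lemma continuous_on_minimal: "continuous_on {0..} (\<lambda>t. minimal t i j)"
proof (rule lipschitz_on_continuous_on[OF lipschitz_onI])
  fix s t :: real
  assume "s \<in> {0..}" "t \<in> {0..}"
  then show "dist (minimal s i j) (minimal t i j) \<le> (\<Sum>k\<in>column_support j. \<bar>Q k j\<bar>) * dist s t"
    using minimal_lipschitz[of s t i j] minimal_lipschitz[of t s i j]
    by (cases "s \<le> t") (auto simp: dist_real_def abs_minus_commute)
qed (simp add: sum_nonneg)

text \<open>Derivatives need not pass to the limit, but the integrated forward equation does, by
  dominated convergence with a constant bound.\<close>

lemma minimal_integral_equation:
  assumes "0 \<le> t"
  shows "minimal t i j = minimal 0 i j
           + integral {0..t} (\<lambda>s. \<Sum>k\<in>column_support j. minimal s i k * Q k j)"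
proof -
  obtain N where N: "\<And>n. n \<ge> N \<Longrightarrow> insert j (column_support j) \<subseteq> E n"
    using eventually_subset_E[of "insert j (column_support j)"] finite_column_support
    unfolding eventually_sequentially by blast
  \<comment> \<open>The shift by \<open>N\<close> ensures that every term already has
    \<open>j\<close> and its column support inside the truncation.\<close>
  define g where "g = (\<lambda>n s. \<Sum>k\<in>column_support j. trunc (n + N) s i k * Q k j)"
  have int: "(g n has_integral (trunc (n + N) t i j - trunc (n + N) 0 i j)) {0..t}" for n
    unfolding g_def
  proof (rule fundamental_theorem_of_calculus[OF assms])
    fix s
    show "((\<lambda>t. trunc (n + N) t i j) has_vector_derivative
            (\<Sum>k\<in>column_support j. trunc (n + N) s i k * Q k j)) (at s within {0..t})"
      using trunc_deriv_column[of j "n + N" i s] N[of "n + N"]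
      by (auto simp: has_real_derivative_iff_has_vector_derivative[symmetric]
          intro: has_field_derivative_at_within)
  qed
  have "(\<lambda>n. integral {0..t} (g n)) \<longlonglongrightarrow>
          integral {0..t} (\<lambda>s. \<Sum>k\<in>column_support j. minimal s i k * Q k j)"
  proof (rule dominated_convergence)
    show "g n integrable_on {0..t}" for n using int by blast
    show "(\<lambda>s. \<Sum>k\<in>column_support j. \<bar>Q k j\<bar>) integrable_on {0..t}" by (rule integrable_const_ivl)
    show "norm (g n s) \<le> (\<Sum>k\<in>column_support j. \<bar>Q k j\<bar>)" if "s \<in> {0..t}" for n s
      unfolding g_def using that
      by (simp add: abs_column_sum_le trunc_nonneg trunc_le_1 abs_of_nonneg)
    show "(\<lambda>n. g n s) \<longlonglongrightarrow> (\<Sum>k\<in>column_support j. minimal s i k * Q k j)" if "s \<in> {0..t}" for s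
      unfolding g_def using that
      by (intro tendsto_intros LIMSEQ_ignore_initial_segment LIMSEQ_trunc) auto
  qed
  moreover have "(\<lambda>n. trunc (n + N) t i j - trunc (n + N) 0 i j)
                    \<longlonglongrightarrow> minimal t i j - minimal 0 i j"
    using assms by (intro tendsto_diff LIMSEQ_ignore_initial_segment LIMSEQ_trunc) auto
  ultimately have "integral {0..t} (\<lambda>s. \<Sum>k\<in>column_support j. minimal s i k * Q k j)
      = minimal t i j - minimal 0 i j"
    unfolding integral_unique[OF int] by (rule LIMSEQ_unique)
  then show ?thesis by simp
qed

lemma minimal_deriv:
  assumes "0 \<le> t"
  shows "((\<lambda>s. minimal s i j) has_real_derivative (\<Sum>k\<in>column_support j. minimal t i k * Q k j))
           (at t within {0..})"
proof -
  let ?g = "\<lambda>s. \<Sum>k\<in>column_support j. minimal s i k * Q k j"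
  \<comment> \<open>The interval extends beyond \<open>t\<close>, so that the derivative within it
    at \<open>t\<close> is the one within the half line.\<close>
  have "continuous_on {0..t+1} ?g"
    by (intro continuous_intros continuous_on_subset[OF continuous_on_minimal]) auto
  then have "((\<lambda>s. integral {0..s} ?g) has_real_derivative ?g t) (at t within {0..t+1})"
    using assms by (intro integral_has_real_derivative) auto
  then have "((\<lambda>s. minimal 0 i j + integral {0..s} ?g) has_real_derivative 0 + ?g t) (at t within {0..t+1})"
    by (intro DERIV_add) auto
  then have "((\<lambda>s. minimal s i j) has_real_derivative ?g t) (at t within {0..t+1})"
    unfolding add_0_left by (rule has_field_derivative_transform_within[of _ _ _ _ 1])
       (use assms in \<open>auto simp: minimal_integral_equation[symmetric]\<close>)
  moreover have "at t within {0..t+1} = at t within {0..}"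
    by (rule at_within_nhd[of _ "{..<t+1}"]) auto
  ultimately show ?thesis by simp
qed

lemma infsum_column: "(\<Sum>\<^sub>\<infinity>k. p k * Q k j) = (\<Sum>k\<in>column_support j. p k * Q k j)"
  and summable_column: "(\<lambda>k. p k * Q k j) summable_on UNIV"
proof -
  have "((\<lambda>k. p k * Q k j) has_sum (\<Sum>k\<in>column_support j. p k * Q k j)) UNIV"
    by (rule has_sum_finite_neutralI[OF finite_column_support]) (auto simp: column_support_def)
  then show "(\<Sum>\<^sub>\<infinity>k. p k * Q k j) = (\<Sum>k\<in>column_support j. p k * Q k j)"
    and "(\<lambda>k. p k * Q k j) summable_on UNIV"
    by (auto simp: infsumI summable_on_def)
qed

lemma forward_equation_minimal: "forward_equation Q minimal"
  unfolding forward_equation_def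
  by (simp add: infsum_column summable_column minimal_deriv)

lemma transition_function_minimal: "transition_function minimal"
  unfolding transition_function_def
proof (intro conjI allI impI)
  fix i j
  have "((\<lambda>t. minimal t i j) \<longlongrightarrow> minimal 0 i j) (at 0 within {0..})"
    using continuous_on_minimal[of i j] by (auto simp: continuous_on_def)
  then show "((\<lambda>t. minimal t i j) \<longlongrightarrow> of_bool (i = j)) (at_right 0)"
    unfolding minimal_0 by (rule tendsto_within_subset) auto
qed (simp_all add: minimal_nonneg minimal_summable minimal_0 minimal_add
      infsum_le_finite_sums minimal_row_sum_le)

section \<open>Minimality, and uniqueness under honesty\<close>

lemma forward_equation_imp_Q_function:
  assumes "transition_function P" "forward_equation Q P"
  shows "Q_function Q P"
proof -
  \<comment> \<open>At time 0 \<open>P\<close> is the identity, so the forward equation there gives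
    exactly the derivative \<open>Q i j\<close>. If \<open>i\<close> lies outside the column
    support, both sides vanish.\<close>
  have "(\<Sum>k\<in>column_support j. P 0 i k * Q k j) = Q i j" for i j
  proof -
    have "(\<Sum>k\<in>column_support j. P 0 i k * Q k j) = (\<Sum>k\<in>column_support j. if k = i then Q k j else 0)"
      using assms(1) by (intro sum.cong refl) (auto simp: transition_function_def)
    also have "\<dots> = Q i j"
      using finite_column_support[of j] by (auto simp: column_support_def)
    finally show ?thesis .
  qed
  then show ?thesis
    using assms unfolding Q_function_def forward_equation_def infsum_column by (metis order_refl)
qed

text \<open>Chapman-Kolmogorov restricted to \<open>E n\<close> is the inequality that puts each
  truncation below \<open>P\<close>; the limit inherits the bound.\<close>

lemma minimal_le_Q_function:
  assumes "Q_function Q P" "0 \<le> t"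
  shows "minimal t i j \<le> P t i j"
proof (rule LIMSEQ_le_const2[OF LIMSEQ_trunc])
  have P: "transition_function P"
    using assms(1) by (simp add: Q_function_def)
  then have nonneg: "0 \<le> P t i j" if "0 \<le> t" for t i j
    using that by (simp add: transition_function_def)
  have "trunc n t i j \<le> P t i j" for n
  proof (rule trunc_le_supersemigroup[OF nonneg])
    fix s t :: real and i j
    assume st: "0 \<le> s" "0 \<le> t"
    have "(\<Sum>j\<in>E n. P t i j) \<le> infsum (P t i) UNIV"
      using P st nonneg by (intro finite_sum_le_infsum finite_E) (auto simp: transition_function_def)
    also have "\<dots> \<le> 1" using P st by (simp add: transition_function_def)
    finally show "(\<Sum>j\<in>E n. P t i j) \<le> 1" .
    have "((\<lambda>k. P s i k * P t k j) has_sum P (s + t) i j) UNIV"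
      using P st by (simp add: transition_function_def)
    then show "(\<Sum>k\<in>E n. P s i k * P t k j) \<le> P (s + t) i j"
      by (rule finite_sum_le_has_sum) (auto intro: finite_E mult_nonneg_nonneg nonneg st)
  next
    fix i j
    show "P 0 i j = of_bool (i = j)"
      using P by (simp add: transition_function_def)
    show "((\<lambda>t. P t i j) has_real_derivative Q i j) (at 0 within {0..})"
      using assms(1) by (simp add: Q_function_def)
  qed (use assms(2) in simp_all)
  then show "\<exists>N. \<forall>n\<ge>N. trunc n t i j \<le> P t i j" by blast
qed fact

lemma Feller_minimal_minimal: "Feller_minimal Q minimal"
  unfolding Feller_minimal_def
  using forward_equation_imp_Q_function transition_function_minimal forward_equation_minimal
    minimal_le_Q_function by blast

text \<open>\<open>P - minimal\<close> is nonnegative by minimality, and its row has total mass at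
  most 1 - 1 = 0.\<close>

lemma Q_function_eq_minimal:
  assumes "Q_function Q P" "0 \<le> t"
    and honest: "infsum (minimal t i) UNIV = 1"
  shows "P t i j = minimal t i j"
proof -
  have P: "P t i summable_on UNIV" "infsum (P t i) UNIV \<le> 1"
    using assms(1,2) by (auto simp: Q_function_def transition_function_def)
  have sum: "(\<lambda>j. P t i j - minimal t i j) summable_on UNIV"
    using summable_on_add[OF P(1) summable_on_uminus[THEN iffD2, OF minimal_summable[OF assms(2), of i UNIV]]]
    by simp
  have "infsum (\<lambda>j. P t i j - minimal t i j) UNIV \<le> 0"
    using infsum_add[OF P(1) summable_on_uminus[THEN iffD2, OF minimal_summable[OF assms(2), of i UNIV]]] P(2) honest
    by (simp add: infsum_uminus)
  then have "P t i j - minimal t i j = 0"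
    by (rule nonneg_infsum_le_0D) (auto intro: sum minimal_le_Q_function assms)
  then show ?thesis by simp
qed

end

section \<open>Honesty from a drift condition\<close>

lemma summable_on_mult_bounded:
  fixes f w :: "'a \<Rightarrow> real"
  assumes "f summable_on A" "\<And>x. x \<in> A \<Longrightarrow> \<bar>w x\<bar> \<le> 1"
  shows "(\<lambda>x. f x * w x) summable_on A"
proof -
  have "(\<lambda>x. norm (f x)) summable_on A"
    using assms(1) summable_on_iff_abs_summable_on_real by blast
  then have "(\<lambda>x. norm (f x * w x)) summable_on A"
    by (rule summable_on_comparison_test) (auto simp: abs_mult assms(2) mult_left_le)
  then show ?thesis by (rule abs_summable_summable)
qed

text \<open>\<open>V\<close> stands for the size of a state, and the error \<open>\<eta>\<close> in
  \<open>drift\<close> is uniform over states. Differentiation takes place on the truncations, where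
  all sums are finite; the linear bound on the exit rates controls what truncating loses.\<close>

lemma (in column_finite_qmatrix) minimal_honest:
  fixes V :: "'s \<Rightarrow> nat" and c C :: real
  assumes E: "\<And>n. E n = {i. V i \<le> n}"
    and conservative: "\<And>i. (Q i has_sum 0) UNIV"
    and C: "0 \<le> C" "\<And>i. - Q i i \<le> C * (1 + real (V i))"
    and c: "0 \<le> c"
    and drift: "\<And>\<eta>. \<eta> > 0 \<Longrightarrow> \<exists>\<delta>. 0 < \<delta> \<and> (\<forall>(s::real) i. 0 < s \<longrightarrow> 1 - (\<delta>::real) \<le> s \<longrightarrow> s < 1 \<longrightarrow>
        - (c * (1 - s) * (V i * s ^ (V i - 1))) - \<eta> \<le> (\<Sum>\<^sub>\<infinity>j. Q i j * s ^ V j))"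
    and t: "0 \<le> t"
  shows "infsum (minimal t i) UNIV = 1"
proof -
  \<comment> \<open>A truncated row omits only targets with \<open>V j > n\<close>, each weighted by
    at most \<open>s ^ n\<close>; their total rate is at most the exit rate, hence at most
    \<open>C * (1 + n)\<close>.\<close>
  have trunc_drift: "infsum (\<lambda>j. Q k j * s ^ V j) UNIV - s ^ n * (C * (1 + real n))
      \<le> (\<Sum>j\<in>E n. Q k j * s ^ V j)"
    if k: "k \<in> E n" and s: "0 < s" "s < 1" for n k and s :: real
  proof -
    \<comment> \<open>Outside \<open>E n\<close> the weight \<open>s ^ V j\<close> is raised to
      \<open>s ^ n\<close>. As the row sums to 0, subtracting the constant weight
      \<open>s ^ n\<close> leaves a finite sum over \<open>E n\<close>.\<close>
    let ?g = "\<lambda>j. s ^ n * Q k j + (if j \<in> E n then Q k j * (s ^ V j - s ^ n) else 0)"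
    have "((\<lambda>j. Q k j * s ^ V j) has_sum infsum (\<lambda>j. Q k j * s ^ V j) UNIV) UNIV"
      using s by (intro has_sum_infsum summable_on_mult_bounded[OF has_sum_imp_summable[OF conservative]])
        (auto simp: power_le_one)
    moreover have "(?g has_sum (s ^ n * 0 + (\<Sum>j\<in>E n. Q k j * (s ^ V j - s ^ n)))) UNIV"
      by (intro has_sum_add has_sum_cmult_right conservative
          has_sum_finite_neutralI[OF finite_E]) auto
    moreover have "Q k j * s ^ V j \<le> ?g j" for j
    proof (cases "j \<in> E n")
      case False
      then have "s ^ V j \<le> s ^ n" using s by (intro power_decreasing) (auto simp: E)
      then show ?thesis
        using False k off_diag_nonneg[of k j] mult_left_mono[of "s ^ V j" "s ^ n" "Q k j"]
        by (auto simp: mult.commute)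
    qed (simp add: algebra_simps)
    ultimately have "infsum (\<lambda>j. Q k j * s ^ V j) UNIV \<le> (\<Sum>j\<in>E n. Q k j * (s ^ V j - s ^ n))"
      by (auto dest: has_sum_mono)
    also have "\<dots> = (\<Sum>j\<in>E n. Q k j * s ^ V j) + s ^ n * - (\<Sum>j\<in>E n. Q k j)"
      by (simp add: right_diff_distrib sum_subtractf sum_distrib_left mult.commute)
    finally have *: "infsum (\<lambda>j. Q k j * s ^ V j) UNIV
        \<le> (\<Sum>j\<in>E n. Q k j * s ^ V j) + s ^ n * - (\<Sum>j\<in>E n. Q k j)" .
    have "Q k k \<le> (\<Sum>j\<in>E n. Q k j)"
      using k finite_E off_diag_nonneg by (intro member_le_sum) auto
    moreover have "- Q k k \<le> C * (1 + real n)"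
      using C(2)[of k] k mult_left_mono[OF _ C(1), of "1 + real (V k)" "1 + real n"] by (simp add: E)
    ultimately have "s ^ n * - (\<Sum>j\<in>E n. Q k j) \<le> s ^ n * (C * (1 + real n))"
      using s by (intro mult_left_mono) auto
    with * show ?thesis by simp
  qed
  \<comment> \<open>One \<open>\<eta>\<close> pays for the initial defect
    \<open>1 - s ^ V i\<close>, the other \<open>t * \<eta>\<close> for the drift error accumulated
    up to \<open>t\<close>.\<close>
  have "1 \<le> infsum (minimal t i) UNIV + (1 + t) * \<eta>" if \<eta>: "\<eta> > 0" for \<eta>
  proof -
    obtain \<delta> :: real where \<delta>: "\<delta> > 0"
      "\<And>(s::real) i. 0 < s \<Longrightarrow> 1 - \<delta> \<le> s \<Longrightarrow> s < 1 \<Longrightarrow>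
        - (c * (1 - s) * (V i * s ^ (V i - 1))) - \<eta> \<le> (\<Sum>\<^sub>\<infinity>j. Q i j * s ^ V j)"
      using drift[OF \<eta>] by blast
    have "((\<lambda>s::real. s ^ V i) \<longlongrightarrow> 1 ^ V i) (at_left 1)"
      by (intro tendsto_intros)
    then have "eventually (\<lambda>s. 1 - \<eta> < s ^ V i) (at_left (1::real))"
      using \<eta> by (intro order_tendstoD) auto
    moreover have "eventually (\<lambda>s. s \<in> {max 0 (1 - \<delta>)<..<1}) (at_left (1::real))"
      using \<delta>(1) by (intro eventually_at_left_real) auto
    ultimately have "eventually (\<lambda>s. 1 - \<eta> < s ^ V i \<and> s \<in> {max 0 (1 - \<delta>)<..<1}) (at_left (1::real))"
      by (rule eventually_conj)
    then obtain s where s: "1 - \<eta> < s ^ V i" "0 < s" "1 - \<delta> < s" "s < 1"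
      using eventually_happens[of _ "at_left (1::real)"] by (auto simp: trivial_limit_at_left_real)
    \<comment> \<open>The solution of \<open>\<sigma>' = c * (1 - \<sigma>)\<close> started at
      \<open>s\<close>. It increases and stays below 1, so the drift inequality is available along
      its whole course.\<close>
    define \<sigma> where "\<sigma> = (\<lambda>u. 1 - (1 - s) * exp (- c * u))"
    have \<sigma>_0: "\<sigma> 0 = s" by (simp add: \<sigma>_def)
    have \<sigma>_mono: "\<sigma> u \<le> \<sigma> v" if "u \<le> v" for u v
      using that s c by (auto simp: \<sigma>_def intro!: mult_left_mono)
    have \<sigma>: "0 < \<sigma> u" "1 - \<delta> \<le> \<sigma> u" "\<sigma> u < 1" if "0 \<le> u" for u
      using \<sigma>_mono[OF that] s by (auto simp: \<sigma>_0) (auto simp: \<sigma>_def)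
    have \<sigma>_deriv: "(\<sigma> has_real_derivative c * (1 - \<sigma> u)) (at u)" for u
      unfolding \<sigma>_def by (auto intro!: derivative_eq_intros)
    have bound: "1 - \<eta> - t * (\<eta> + \<sigma> t ^ n * (C * (1 + real n))) \<le> infsum (minimal t i) UNIV"
      if n: "V i \<le> n" for n
    proof -
      \<comment> \<open>Drift error plus truncation loss; as \<open>\<sigma>\<close> increases, its
        value at \<open>t\<close> covers all earlier times.\<close>
      define \<kappa> where "\<kappa> = \<eta> + \<sigma> t ^ n * (C * (1 + real n))"
      define \<psi> where "\<psi> = (\<lambda>u. \<Sum>j\<in>E n. trunc n u i j * \<sigma> u ^ V j)"
      \<comment> \<open>The first summand comes from the forward equation, the second from the
        motion of \<open>\<sigma>\<close>; the latter cancels the negative term in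
        \<open>drift\<close>.\<close>
      let ?d = "\<lambda>u k. (\<Sum>j\<in>E n. Q k j * \<sigma> u ^ V j) + c * (1 - \<sigma> u) * (V k * \<sigma> u ^ (V k - 1))"
      have "(\<psi> has_real_derivative (\<Sum>k\<in>E n. trunc n u i k * ?d u k)) (at u)" for u
      proof -
        have "(\<psi> has_real_derivative (\<Sum>j\<in>E n. (\<Sum>k\<in>E n. trunc n u i k * Q k j) * \<sigma> u ^ V j +
            (V j * (c * (1 - \<sigma> u)) * \<sigma> u ^ (V j - 1)) * trunc n u i j)) (at u)"
          unfolding \<psi>_def
          by (intro DERIV_sum DERIV_mult trunc_deriv) (auto intro!: derivative_eq_intros \<sigma>_deriv)
        also have "(\<Sum>j\<in>E n. (\<Sum>k\<in>E n. trunc n u i k * Q k j) * \<sigma> u ^ V j +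
            (V j * (c * (1 - \<sigma> u)) * \<sigma> u ^ (V j - 1)) * trunc n u i j)
          = (\<Sum>j\<in>E n. \<Sum>k\<in>E n. trunc n u i k * (Q k j * \<sigma> u ^ V j)) +
            (\<Sum>j\<in>E n. trunc n u i j * (c * (1 - \<sigma> u) * (V j * \<sigma> u ^ (V j - 1))))"
          by (simp add: sum.distrib sum_distrib_left sum_distrib_right mult_ac)
        also have "(\<Sum>j\<in>E n. \<Sum>k\<in>E n. trunc n u i k * (Q k j * \<sigma> u ^ V j))
          = (\<Sum>k\<in>E n. trunc n u i k * (\<Sum>j\<in>E n. Q k j * \<sigma> u ^ V j))"
          unfolding sum_distrib_left by (rule sum.swap)
        finally show ?thesis by (simp only: distrib_left sum.distrib)
      qed
      then have deriv: "((\<lambda>u. \<psi> u + \<kappa> * u) has_real_derivative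
          (\<Sum>k\<in>E n. trunc n u i k * ?d u k) + \<kappa>) (at u)" for u
        by (auto intro!: derivative_eq_intros)
      have "\<psi> 0 + \<kappa> * 0 \<le> \<psi> t + \<kappa> * t"
      proof (rule DERIV_nonneg_imp_nondecreasing[OF t])
        fix u assume u: "0 \<le> u" "u \<le> t"
        have \<kappa>: "- \<kappa> \<le> ?d u k" if k: "k \<in> E n" for k
        proof -
          have "\<sigma> u ^ n * (C * (1 + real n)) \<le> \<sigma> t ^ n * (C * (1 + real n))"
            using \<sigma>[OF u(1)] \<sigma>_mono[OF u(2)] C(1) by (intro mult_right_mono power_mono) auto
          then show ?thesis
            using trunc_drift[OF k \<sigma>(1,3)[OF u(1)]] \<delta>(2)[OF \<sigma>[OF u(1)], of k] by (simp add: \<kappa>_def)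
        qed
        have "0 \<le> \<kappa>" using \<eta> C(1) \<sigma>[OF t] by (auto simp: \<kappa>_def)
        then have "- \<kappa> \<le> - \<kappa> * (\<Sum>k\<in>E n. trunc n u i k)"
          using trunc_row_sum_le_E[OF u(1)] by (simp add: mult_left_le)
        also have "\<dots> = (\<Sum>k\<in>E n. trunc n u i k * - \<kappa>)"
          by (simp add: sum_distrib_left sum_negf mult.commute)
        also have "\<dots> \<le> (\<Sum>k\<in>E n. trunc n u i k * ?d u k)"
          by (intro sum_mono mult_left_mono \<kappa> trunc_nonneg u)
        finally show "\<exists>y. ((\<lambda>u. \<psi> u + \<kappa> * u) has_real_derivative y) (at u) \<and> 0 \<le> y"
          using deriv[of u] by force
      qed
      moreover have "\<psi> 0 = s ^ V i"
      proof -
        have "\<psi> 0 = (\<Sum>j\<in>E n. if j = i then \<sigma> 0 ^ V j else 0)"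
          unfolding \<psi>_def using n by (intro sum.cong refl) (auto simp: trunc_0 E)
        then show ?thesis using n finite_E by (simp add: \<sigma>_0 E)
      qed
      moreover have "\<psi> t \<le> (\<Sum>j\<in>E n. minimal t i j)"
      proof -
        have "trunc n t i j * \<sigma> t ^ V j \<le> minimal t i j * 1" for j
          using \<sigma>[OF t] t by (intro mult_mono trunc_le_minimal power_le_one minimal_nonneg) auto
        then show ?thesis unfolding \<psi>_def by (intro sum_mono) auto
      qed
      moreover have "(\<Sum>j\<in>E n. minimal t i j) \<le> infsum (minimal t i) UNIV"
        by (intro finite_sum_le_infsum minimal_summable minimal_nonneg finite_E t) auto
      ultimately show ?thesis using s(1) by (simp add: \<kappa>_def mult.commute)
    qed
    \<comment> \<open>For fixed \<open>t\<close> the linear growth of the exit rates loses against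
      the geometric factor, so the truncation loss vanishes as n grows.\<close>
    have lim: "(\<lambda>n. \<sigma> t ^ n) \<longlonglongrightarrow> 0" "(\<lambda>n. real n * \<sigma> t ^ n) \<longlonglongrightarrow> 0"
      using \<sigma>[OF t] by (simp_all add: LIMSEQ_power_zero powser_times_n_limit_0)
    have "(\<lambda>n. 1 - \<eta> - t * (\<eta> + C * (\<sigma> t ^ n + real n * \<sigma> t ^ n)))
                 \<longlonglongrightarrow> 1 - \<eta> - t * (\<eta> + C * (0 + 0))"
      by (intro tendsto_diff tendsto_const tendsto_mult[OF tendsto_const] tendsto_add lim)
    then have "1 - \<eta> - t * (\<eta> + C * (0 + 0)) \<le> infsum (minimal t i) UNIV"
      by (rule LIMSEQ_le_const2) (use bound in \<open>auto simp: algebra_simps\<close>)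
    then show ?thesis by (simp add: algebra_simps)
  qed
  \<comment> \<open>Take \<open>\<eta> = e / (1 + t)\<close>.\<close>
  then have "1 \<le> infsum (minimal t i) UNIV + e" if "e > 0" for e
    using that t by (metis add_pos_nonneg divide_pos_pos less_irrefl nonzero_mult_div_cancel_left
        times_divide_eq_right zero_less_one)
  then have "1 \<le> infsum (minimal t i) UNIV"
    by (rule field_le_epsilon)
  moreover have "infsum (minimal t i) UNIV \<le> 1"
    using t by (intro infsum_le_finite_sums minimal_summable minimal_row_sum_le)
  ultimately show ?thesis by simp
qed

section \<open>Branching rates on vectors of naturals\<close>

lemma has_sum_finite_sum:
  fixes f :: "'a \<Rightarrow> 'b \<Rightarrow> real"
  assumes "\<And>x. x \<in> X \<Longrightarrow> (f x has_sum S x) A"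
  shows "((\<lambda>y. \<Sum>x\<in>X. f x y) has_sum (\<Sum>x\<in>X. S x)) A"
  using assms by (induction X rule: infinite_finite_induct) (auto intro: has_sum_add)

definition total :: "nat ^ 'n::finite \<Rightarrow> nat" where
  "total i = (\<Sum>k\<in>UNIV. i $ k)"

lemma total_0 [simp]: "total 0 = 0"
  by (simp add: total_def)

lemma total_axis [simp]: "total (axis k 1) = 1"
  by (simp add: total_def axis_def)

lemma total_add: "total (i + j) = total i + total j"
  by (simp add: total_def sum.distrib)

lemma total_mono: "i \<le> j \<Longrightarrow> total i \<le> total j"
  by (auto simp: total_def less_eq_vec_def intro: sum_mono)

lemma nth_le_total: "i $ k \<le> total i"
  unfolding total_def by (rule member_le_sum) auto

lemma axis_le_iff: "axis k 1 \<le> i \<longleftrightarrow> 0 < i $ k" for i :: "nat ^ 'n"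
  by (auto simp: less_eq_vec_def axis_def Suc_le_eq)

lemma finite_total_le: "finite {i :: nat ^ 'n::finite. total i \<le> n}"
proof (rule finite_subset)
  show "{i :: nat ^ 'n. total i \<le> n} \<subseteq> vec_lambda ` (UNIV \<rightarrow>\<^sub>E {..n})"
  proof
    fix i :: "nat ^ 'n"
    assume "i \<in> {i. total i \<le> n}"
    then have "vec_nth i \<in> UNIV \<rightarrow>\<^sub>E {..n}"
      using nth_le_total[of i] by (auto intro: order_trans)
    then show "i \<in> vec_lambda ` (UNIV \<rightarrow>\<^sub>E {..n})"
      by (intro image_eqI[of _ _ "vec_nth i"]) auto
  qed
  show "finite (vec_lambda ` (UNIV \<rightarrow>\<^sub>E {..n}) :: (nat ^ 'n) set)"
    by (intro finite_imageI finite_PiE) auto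
qed

section \<open>Generating functions on the diagonal u = (s,...,s)\<close>

definition gen_total :: "(nat ^ 'n::finite \<Rightarrow> real) \<Rightarrow> real \<Rightarrow> real" where
  "gen_total f s = (\<Sum>\<^sub>\<infinity>m. f m * s ^ total m)"

text \<open>Substitute \<open>j = m + (i - e)\<close>; \<open>e \<le> i\<close> makes this
  subtraction exact. The case \<open>e = axis k 1\<close> serves offspring, \<open>e = 0\<close>
  immigration.\<close>

lemma has_sum_shift:
  fixes f :: "nat ^ 'n::finite \<Rightarrow> real"
  assumes e: "e \<le> i" and f: "((\<lambda>m. f m * s ^ total m) has_sum S) UNIV"
  shows "((\<lambda>j. (if i \<le> j + e then f (j + e - i) else 0) * s ^ total j) has_sum
           (s ^ (total i - total e) * S)) UNIV"
proof -
  let ?h = "\<lambda>j. (if i \<le> j + e then f (j + e - i) else 0) * s ^ total j"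
  have e': "e $ x \<le> i $ x" for x using e by (simp add: less_eq_vec_def)
  have ie: "(i - e) + e = i"
    using e' by (simp add: vec_eq_iff)
  then have [simp]: "m + (i - e) + e = m + i" "i \<le> m + i" "m + i - i = m" for m
    by (auto simp: add.assoc less_eq_vec_def vec_eq_iff)
  have total: "total (i - e) = total i - total e"
    using ie by (metis add_diff_cancel_right' total_add)
  have "((\<lambda>m. s ^ (total i - total e) * (f m * s ^ total m)) has_sum (s ^ (total i - total e) * S)) UNIV"
    using f by (rule has_sum_cmult_right)
  then have "((\<lambda>m. ?h (m + (i - e))) has_sum (s ^ (total i - total e) * S)) UNIV"
    by (simp add: total_add total power_add mult_ac)
  moreover have "bij_betw (\<lambda>m. m + (i - e)) UNIV {j. i \<le> j + e}"
  proof (rule bij_betwI[of _ _ _ "\<lambda>j. j + e - i"])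
    show "j + e - i + (i - e) = j" if "j \<in> {j. i \<le> j + e}" for j
    proof -
      have "i $ x \<le> j $ x + e $ x" for x using that by (auto simp: less_eq_vec_def)
      then show ?thesis using e' by (simp add: vec_eq_iff)
    qed
  qed auto
  ultimately have "(?h has_sum (s ^ (total i - total e) * S)) {j. i \<le> j + e}"
    using has_sum_reindex_bij_betw[of _ UNIV "{j. i \<le> j + e}" ?h] by blast
  then show ?thesis
    by (rule has_sum_cong_neutral[THEN iffD1, rotated -1]) auto
qed

lemma one_minus_power_le: "1 - s ^ n \<le> n * (1 - s)" if "0 \<le> s" "s \<le> 1" for s :: real
  using Bernoulli_inequality[of "s - 1" n] that by (simp add: algebra_simps)

text \<open>Common frame for the three kinds of rates: \<open>p = 0\<close> for \<open>h\<close> and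
  \<open>a\<close>, \<open>p = axis k 1\<close> for \<open>b k\<close>.\<close>

locale conservative_rates =
  fixes f :: "nat ^ 'n::finite \<Rightarrow> real" and p :: "nat ^ 'n"
  assumes nonneg: "\<And>m. m \<noteq> p \<Longrightarrow> 0 \<le> f m"
    and has_sum_off: "(f has_sum - f p) (UNIV - {p})"
begin

lemma diag_nonpos: "f p \<le> 0"
  using has_sum_nonneg[OF has_sum_off] nonneg by force

lemma has_sum_UNIV: "(f has_sum 0) UNIV"
proof -
  have "(f has_sum (- f p + f p)) (UNIV - {p} \<union> {p})"
    by (rule has_sum_Un_disjoint[OF has_sum_off]) (auto intro: has_sum_finiteI)
  then show ?thesis by simp
qed

lemma summable_weighted: "(\<And>m. \<bar>w m\<bar> \<le> 1) \<Longrightarrow> (\<lambda>m. f m * w m) summable_on UNIV"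
  by (rule summable_on_mult_bounded[OF has_sum_imp_summable[OF has_sum_UNIV]])

lemma has_sum_gen_total:
  "0 \<le> s \<Longrightarrow> s \<le> 1 \<Longrightarrow> ((\<lambda>m. f m * s ^ total m) has_sum gen_total f s) UNIV"
  unfolding gen_total_def by (intro has_sum_infsum summable_weighted) (simp add: power_le_one)

lemma gen_total_1: "gen_total f 1 = 0"
  unfolding gen_total_def using infsumI[OF has_sum_UNIV] by simp

text \<open>The rates sum to 0, so \<open>- gen_total f s\<close> is the sum of
  \<open>f m * (s - s ^ total m)\<close>. The term at \<open>p\<close> vanishes because
  \<open>total p = 1\<close>, and for nonnegative rates Bernoulli's inequality gives
  \<open>s - s ^ total m \<le> total m * (1 - s)\<close>.\<close>

lemma gen_total_ge_linear:
  assumes p: "total p = 1"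
    and mean: "\<And>K. finite K \<Longrightarrow> p \<notin> K \<Longrightarrow> (\<Sum>m\<in>K. f m * total m) \<le> M"
    and s: "0 \<le> s" "s \<le> 1"
  shows "- (M * (1 - s)) \<le> gen_total f s"
proof -
  have "((\<lambda>m. f m * s + - (f m * s ^ total m)) has_sum (0 * s + - gen_total f s)) UNIV"
    using s by (intro has_sum_add has_sum_cmult_left has_sum_UNIV has_sum_uminusI has_sum_gen_total)
  then have "0 * s + - gen_total f s \<le> M * (1 - s)"
  proof (rule has_sum_le_finite_sums)
    fix K :: "(nat ^ 'n) set" assume K: "finite K"
    have "(\<Sum>m\<in>K. f m * s + - (f m * s ^ total m)) = (\<Sum>m\<in>K - {p}. f m * s + - (f m * s ^ total m))"
      using K p by (intro sum.mono_neutral_right) auto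
    also have "\<dots> \<le> (\<Sum>m\<in>K - {p}. f m * total m * (1 - s))"
    proof (rule sum_mono)
      fix m assume "m \<in> K - {p}"
      moreover have "s - s ^ total m \<le> total m * (1 - s)"
        using one_minus_power_le[OF s, of "total m"] s by linarith
      ultimately show "f m * s + - (f m * s ^ total m) \<le> f m * total m * (1 - s)"
        using mult_left_mono[OF _ nonneg[of m]] by (fastforce simp: algebra_simps)
    qed
    also have "\<dots> \<le> M * (1 - s)"
      unfolding sum_distrib_right[symmetric] using K s by (intro mult_right_mono mean) auto
    finally show "(\<Sum>m\<in>K. f m * s + - (f m * s ^ total m)) \<le> M * (1 - s)" .
  qed
  then show ?thesis by simp
qed

text \<open>For \<open>h\<close> and \<open>a\<close>, whose means may be infinite: a finite set of
  terms has sum close to 0 and is continuous at 1, and the terms left out only increase the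
  value.\<close>

lemma eventually_gen_total_ge:
  assumes "\<eta> > 0"
  shows "eventually (\<lambda>s. - \<eta> \<le> gen_total f s) (at_left 1)"
proof -
  have "eventually (\<lambda>K. dist (sum f K) 0 < \<eta>) (finite_subsets_at_top UNIV)"
    using has_sum_UNIV assms unfolding has_sum_def by (rule tendstoD)
  then obtain K0 where K0: "finite K0" "\<And>K. finite K \<Longrightarrow> K0 \<subseteq> K \<Longrightarrow> dist (sum f K) 0 < \<eta>"
    by (auto simp: eventually_finite_subsets_at_top)
  \<comment> \<open>Adjoining \<open>p\<close> makes all omitted terms nonnegative.\<close>
  define K where "K = insert p K0"
  have K: "finite K" "p \<in> K" using K0 by (auto simp: K_def)
  have "K0 \<subseteq> K" by (auto simp: K_def)
  then have "- \<eta> < sum f K" using K0(2)[OF K(1)] by (simp add: dist_real_def)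
  moreover have "((\<lambda>s. \<Sum>m\<in>K. f m * s ^ total m) \<longlongrightarrow> (\<Sum>m\<in>K. f m * 1 ^ total m)) (at_left 1)"
    by (intro tendsto_intros)
  ultimately have "eventually (\<lambda>s. - \<eta> < (\<Sum>m\<in>K. f m * s ^ total m)) (at_left 1)"
    by (intro order_tendstoD) auto
  moreover have "eventually (\<lambda>s. s \<in> {0<..<1}) (at_left (1::real))"
    by (intro eventually_at_left_real) auto
  ultimately show ?thesis
  proof eventually_elim
    case (elim s)
    have "(\<Sum>m\<in>K. f m * s ^ total m) \<le> gen_total f s"
      using elim K by (intro finite_sum_le_has_sum[OF has_sum_gen_total]) (auto intro!: mult_nonneg_nonneg nonneg)
    with elim show ?case by simp
  qed
qed

text \<open>The left-hand difference quotients at \<open>1\<close> dominate those of every partial sum that contains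
  the only negative term.\<close>

lemma finite_derivative_imp_bounded_mean:
  fixes v :: "nat ^ 'n \<Rightarrow> nat"
  assumes "((\<lambda>s. \<Sum>\<^sub>\<infinity>m. f m * s ^ v m) has_real_derivative d) (at_left 1)"
    and K: "finite K" "p \<notin> K"
  shows "(\<Sum>m\<in>K. f m * v m) \<le> d - f p * v p"
proof -
  define F where "F = (\<lambda>s. \<Sum>\<^sub>\<infinity>m. f m * s ^ v m)"
  define \<phi> where "\<phi> = (\<lambda>s. \<Sum>m\<in>insert p K. f m * s ^ v m)"
  have F: "((\<lambda>m. f m * s ^ v m) has_sum F s) UNIV" if "0 \<le> s" "s \<le> 1" for s
    unfolding F_def using that by (intro has_sum_infsum summable_weighted) (simp add: power_le_one)
  have "(\<phi> has_real_derivative (\<Sum>m\<in>insert p K. f m * v m)) (at_left 1)"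
    unfolding \<phi>_def by (auto intro!: derivative_eq_intros sum.cong)
  then have lim_\<phi>: "((\<lambda>s. (\<phi> s - \<phi> 1) / (s - 1)) \<longlongrightarrow> (\<Sum>m\<in>insert p K. f m * v m)) (at_left 1)"
    by (simp add: has_field_derivative_iff)
  have lim_F: "((\<lambda>s. (F s - F 1) / (s - 1)) \<longlongrightarrow> d) (at_left 1)"
    using assms(1) by (simp add: F_def has_field_derivative_iff)
  have le: "eventually (\<lambda>s. (\<phi> s - \<phi> 1) / (s - 1) \<le> (F s - F 1) / (s - 1)) (at_left 1)"
  proof -
    have "eventually (\<lambda>s. s \<in> {0<..<1}) (at_left (1::real))"
      by (intro eventually_at_left_real) auto
    then show ?thesis
    proof eventually_elim
      case (elim s)
      have "((\<lambda>m. f m * 1 ^ v m + - (f m * s ^ v m)) has_sum (F 1 + - F s)) UNIV"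
        using elim by (intro has_sum_add has_sum_uminusI F) auto
      then have "(\<Sum>m\<in>insert p K. f m * 1 ^ v m + - (f m * s ^ v m)) \<le> F 1 + - F s"
        using K elim
        by (rule_tac finite_sum_le_has_sum)
           (auto simp: mult_le_cancel_left1 power_le_one intro!: mult_left_le nonneg)
      then have "\<phi> 1 - \<phi> s \<le> F 1 - F s"
        by (simp add: \<phi>_def sum_subtractf)
      then show ?case using elim by (simp add: divide_simps)
    qed
  qed
  have "(\<Sum>m\<in>insert p K. f m * v m) \<le> d"
    by (rule tendsto_le[OF _ lim_F lim_\<phi> le]) simp
  then show ?thesis using K by simp
qed

end

lemma B_slice_1:
  fixes b :: "'n::finite \<Rightarrow> nat ^ 'n \<Rightarrow> real"
  shows "B_slice b i j 1 = (\<lambda>s. \<Sum>\<^sub>\<infinity>m. b i m * s ^ (m $ j))"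
proof
  fix s
  have "(\<Prod>k\<in>UNIV. ((\<chi> k. if k = j then s else (1 :: real ^ 'n) $ k) $ k) ^ (m $ k)) = s ^ (m $ j)"
    for m :: "nat ^ 'n"
  proof -
    have "(\<Prod>k\<in>UNIV. ((\<chi> k. if k = j then s else (1 :: real ^ 'n) $ k) $ k) ^ (m $ k))
        = (\<Prod>k\<in>UNIV. if k = j then s ^ (m $ k) else 1)"
      by (intro prod.cong) auto
    then show ?thesis by simp
  qed
  then show "B_slice b i j 1 s = (\<Sum>\<^sub>\<infinity>m. b i m * s ^ (m $ j))"
    by (simp add: B_slice_def gen_B_def)
qed

section \<open>The branching q-matrix with immigration\<close>

locale nTBI =
  fixes h a :: "nat ^ 'n::finite \<Rightarrow> real"
    and b :: "'n \<Rightarrow> nat ^ 'n \<Rightarrow> real"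
  assumes nTBI_qmatrix: "nTBI_qmatrix h a b (nTBI_matrix h a b)"
    and B_partial_finite: "\<And>i j. B_partial_finite b i j 1"
begin

abbreviation Q :: "nat ^ 'n \<Rightarrow> nat ^ 'n \<Rightarrow> real" where
  "Q \<equiv> nTBI_matrix h a b"

sublocale h: conservative_rates h 0
  using nTBI_qmatrix by unfold_locales (auto simp: nTBI_qmatrix_def)

sublocale a: conservative_rates a 0
  using nTBI_qmatrix by unfold_locales (auto simp: nTBI_qmatrix_def)

sublocale b: conservative_rates "b k" "axis k 1" for k
  using nTBI_qmatrix by unfold_locales (auto simp: nTBI_qmatrix_def)

text \<open>Finiteness of each partial derivative at 1 bounds the mean number of offspring of each
  type; summing over offspring types bounds the mean total, and summing over parent types makes the
  bound uniform in \<open>k\<close>.\<close>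

lemma bounded_mean:
  "\<exists>M\<ge>0. \<forall>k K. finite K \<longrightarrow> axis k 1 \<notin> K \<longrightarrow> (\<Sum>m\<in>K. b k m * total m) \<le> M"
proof -
  have "\<exists>M. \<forall>K. finite K \<longrightarrow> axis k 1 \<notin> K \<longrightarrow> (\<Sum>m\<in>K. b k m * (m $ j)) \<le> M" for k j
  proof -
    obtain d where "(B_slice b k j 1 has_real_derivative d) (at 1 within {-1..1})"
      using B_partial_finite[of k j] by (auto simp: B_partial_finite_def real_differentiable_def)
    then have "((\<lambda>s. \<Sum>\<^sub>\<infinity>m. b k m * s ^ (m $ j)) has_real_derivative d) (at_left 1)"
      by (simp add: B_slice_1 at_within_Icc_at_left)
    from b.finite_derivative_imp_bounded_mean[OF this] show ?thesis by blast
  qed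
  then obtain M where M: "\<And>k j K. finite K \<Longrightarrow> axis k 1 \<notin> K \<Longrightarrow> (\<Sum>m\<in>K. b k m * (m $ j)) \<le> M k j"
    by metis
  have "(\<Sum>m\<in>K. b k m * total m) \<le> (\<Sum>k\<in>UNIV. \<Sum>j\<in>UNIV. \<bar>M k j\<bar>)"
    if K: "finite K" "axis k 1 \<notin> K" for k K
  proof -
    have "(\<Sum>m\<in>K. b k m * total m) = (\<Sum>j\<in>UNIV. \<Sum>m\<in>K. b k m * (m $ j))"
      by (simp add: total_def sum_distrib_left sum.swap[of _ UNIV])
    also have "\<dots> \<le> (\<Sum>j\<in>UNIV. \<bar>M k j\<bar>)"
      by (intro sum_mono order_trans[OF M[OF K]]) simp
    also have "\<dots> \<le> (\<Sum>k\<in>UNIV. \<Sum>j\<in>UNIV. \<bar>M k j\<bar>)"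
      by (rule member_le_sum) (auto intro: sum_nonneg)
    finally show ?thesis .
  qed
  then show ?thesis
    by (intro exI[of _ "\<Sum>k\<in>UNIV. \<Sum>j\<in>UNIV. \<bar>M k j\<bar>"]) (auto intro!: sum_nonneg)
qed

lemma has_sum_row:
  assumes s: "0 \<le> s" "s \<le> 1"
  shows "((\<lambda>j. Q i j * s ^ total j) has_sum
     (if i = 0 then gen_total h s
      else (\<Sum>k\<in>UNIV. (i $ k) * (s ^ (total i - 1) * gen_total (b k) s)) + s ^ total i * gen_total a s)) UNIV"
proof (cases "i = 0")
  case True
  then show ?thesis using h.has_sum_gen_total[OF s] by (simp add: nTBI_matrix_def)
next
  case False
  have "((\<lambda>j. (i $ k) * ((if i \<le> j + axis k 1 then b k (j + axis k 1 - i) else 0) * s ^ total j))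
          has_sum ((i $ k) * (s ^ (total i - 1) * gen_total (b k) s))) UNIV" for k
  \<comment> \<open>Shifting needs \<open>axis k 1 \<le> i\<close>, which fails exactly when
    \<open>i $ k = 0\<close>; then the coefficient removes the term.\<close>
  proof (cases "i $ k = 0")
    case False
    then have "axis k 1 \<le> i" unfolding axis_le_iff by simp
    from has_sum_shift[OF this b.has_sum_gen_total[OF s]] show ?thesis
      by (intro has_sum_cmult_right) (simp del: One_nat_def)
  qed simp
  then have "((\<lambda>j. (\<Sum>k\<in>UNIV. (i $ k) * ((if i \<le> j + axis k 1 then b k (j + axis k 1 - i) else 0) * s ^ total j))
        + (if i \<le> j + 0 then a (j + 0 - i) else 0) * s ^ total j)
      has_sum ((\<Sum>k\<in>UNIV. (i $ k) * (s ^ (total i - 1) * gen_total (b k) s))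
        + s ^ (total i - total (0 :: nat ^ 'n)) * gen_total a s)) UNIV"
    by (intro has_sum_add has_sum_finite_sum has_sum_shift a.has_sum_gen_total s) (auto simp: less_eq_vec_def)
  then show ?thesis using False unfolding add_0_right
    by (simp add: nTBI_matrix_def distrib_right sum_distrib_right mult.assoc del: One_nat_def)
qed

lemma has_sum_row_zero: "(Q i has_sum 0) UNIV"
  using has_sum_row[of 1 i] by (cases "i = 0") (simp_all add: h.gen_total_1 a.gen_total_1 b.gen_total_1)

text \<open>Each particle contributes at least \<open>- M * (1 - s)\<close>, and summing over
  particles produces \<open>total i * s ^ (total i - 1)\<close>, the derivative of
  \<open>s ^ total i\<close>. Immigration carries the factor \<open>s ^ total i \<le> 1\<close>, so
  its error is uniform in \<open>i\<close>; state 0 involves \<open>h\<close> alone.\<close>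

lemma row_gen_ge:
  fixes s M \<eta> :: real
  assumes M: "0 \<le> M" "\<And>k K. finite K \<Longrightarrow> axis k 1 \<notin> K \<Longrightarrow> (\<Sum>m\<in>K. b k m * total m) \<le> M"
    and s: "0 \<le> s" "s \<le> 1"
    and \<eta>: "0 \<le> \<eta>" "- \<eta> \<le> gen_total h s" "- \<eta> \<le> gen_total a s"
  shows "- (M * (1 - s) * (total i * s ^ (total i - 1))) - \<eta> \<le> (\<Sum>\<^sub>\<infinity>j. Q i j * s ^ total j)"
proof (cases "i = 0")
  case True
  then show ?thesis using infsumI[OF has_sum_row[OF s, of i]] \<eta> by simp
next
  case False
  have "- (M * (1 - s) * (total i * s ^ (total i - 1)))
      = (\<Sum>k\<in>UNIV. (i $ k) * (s ^ (total i - 1) * - (M * (1 - s))))"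
    by (simp add: total_def sum_distrib_left sum_distrib_right sum_negf mult_ac)
  also have "\<dots> \<le> (\<Sum>k\<in>UNIV. (i $ k) * (s ^ (total i - 1) * gen_total (b k) s))"
    using s by (intro sum_mono mult_left_mono b.gen_total_ge_linear M) (auto simp del: One_nat_def)
  finally have *: "- (M * (1 - s) * (total i * s ^ (total i - 1)))
      \<le> (\<Sum>k\<in>UNIV. (i $ k) * (s ^ (total i - 1) * gen_total (b k) s))" .
  have "- \<eta> \<le> s ^ total i * - \<eta>"
    using \<eta>(1) s power_le_one[OF s, of "total i"] by (simp add: mult_left_le_one_le)
  also have "\<dots> \<le> s ^ total i * gen_total a s"
    using \<eta>(3) s by (intro mult_left_mono) auto
  finally show ?thesis
    using * infsumI[OF has_sum_row[OF s, of i]] False by simp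
qed

lemma off_diag_nonneg: "i \<noteq> j \<Longrightarrow> 0 \<le> Q i j"
proof -
  assume "i \<noteq> j"
  have "0 \<le> b k (j + axis k 1 - i)" if "i \<le> j + axis k 1" for k
  proof (rule b.nonneg)
    \<comment> \<open>Under the guard the truncated subtraction is exact, so equality would force
      \<open>i = j\<close>.\<close>
    show "j + axis k 1 - i \<noteq> axis k 1"
    proof
      assume eq: "j + axis k 1 - i = axis k 1"
      have "i $ x = j $ x" for x
      proof -
        have "j $ x + (axis k 1 :: nat ^ 'n) $ x - i $ x = (axis k 1 :: nat ^ 'n) $ x"
          using arg_cong[OF eq, of "\<lambda>v. v $ x"] by simp
        moreover have "i $ x \<le> j $ x + (axis k 1 :: nat ^ 'n) $ x"
          using that by (auto simp: less_eq_vec_def)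
        ultimately show ?thesis by linarith
      qed
      with \<open>i \<noteq> j\<close> show False by (simp add: vec_eq_iff)
    qed
  qed
  moreover have "0 \<le> a (j - i)" if "i \<le> j"
  proof (rule a.nonneg)
    show "j - i \<noteq> 0"
      using that \<open>i \<noteq> j\<close> by (auto simp: vec_eq_iff less_eq_vec_def intro: le_antisym)
  qed
  moreover have "0 \<le> h j" if "i = 0" using that \<open>i \<noteq> j\<close> by (intro h.nonneg) auto
  ultimately show ?thesis
    by (auto simp: nTBI_matrix_def intro!: add_nonneg_nonneg sum_nonneg mult_nonneg_nonneg)
qed

text \<open>Exit rates grow at most linearly in the number of particles, as
  \<open>minimal_honest\<close> requires.\<close>

lemma diag_ge:
  "- Q i i \<le> (- h 0 - a 0 - (\<Sum>k\<in>UNIV. b k (axis k 1))) * (1 + real (total i))"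
proof -
  let ?B = "- (\<Sum>k\<in>UNIV. b k (axis k 1))"
  have B: "0 \<le> ?B" using b.diag_nonpos by (simp add: sum_nonpos)
  have "- Q i i \<le> - h 0 - a 0 + ?B * total i"
  proof (cases "i = 0")
    case True
    then show ?thesis using a.diag_nonpos by (simp add: nTBI_matrix_def)
  next
    case False
    have "i + axis k 1 - i = axis k 1" "i \<le> i + axis k 1" for k
      by (auto simp: vec_eq_iff less_eq_vec_def)
    then have "Q i i = (\<Sum>k\<in>UNIV. (i $ k) * b k (axis k 1)) + a 0"
      using False by (simp add: nTBI_matrix_def)
    moreover have "(\<Sum>k\<in>UNIV. total i * b k (axis k 1)) \<le> (\<Sum>k\<in>UNIV. (i $ k) * b k (axis k 1))"
      using nth_le_total[of i] b.diag_nonpos by (intro sum_mono mult_right_mono_neg) auto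
    ultimately show ?thesis using h.diag_nonpos by (simp add: sum_distrib_left mult.commute)
  qed
  also have "\<dots> \<le> (- h 0 - a 0 + ?B) * (1 + real (total i))"
  proof -
    have "0 \<le> (- h 0 - a 0) * real (total i)"
      using h.diag_nonpos a.diag_nonpos by (intro mult_nonneg_nonneg) auto
    then show ?thesis using B by (simp add: algebra_simps)
  qed
  finally show ?thesis by simp
qed

sublocale column_finite_qmatrix Q "\<lambda>n. {i. total i \<le> n}"
proof
  fix i j :: "nat ^ 'n" and K :: "(nat ^ 'n) set" and m n :: nat
  show "0 \<le> Q i j" if "i \<noteq> j" using that by (rule off_diag_nonneg)
  show "(\<Sum>j\<in>K. Q i j) \<le> 0" if "finite K" "i \<in> K"
    using that by (intro finite_sum_le_has_sum[OF has_sum_row_zero]) (auto intro: off_diag_nonneg)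
  show "finite {i. total i \<le> n}" by (rule finite_total_le)
  show "{i. total i \<le> m} \<subseteq> {i. total i \<le> n}" if "m \<le> n" using that by auto
  show "\<exists>n. i \<in> {i. total i \<le> n}" by auto
  show "finite {i. Q i j \<noteq> 0}"
  proof (rule finite_subset[OF _ finite_total_le])
    \<comment> \<open>One transition removes at most one particle, so a state leading to
      \<open>j\<close> has size at most \<open>total j + 1\<close>.\<close>
    have "i \<le> j \<or> (\<exists>k. i \<le> j + axis k 1)" if "Q i j \<noteq> 0" "i \<noteq> 0" for i
      using that by (auto simp: nTBI_matrix_def split: if_splits intro: sum.neutral)
    then have "total i \<le> total j + 1" if "Q i j \<noteq> 0" for i
      using that total_mono[of i j] total_mono[of i "j + axis _ 1"]
      by (cases "i = 0") (fastforce simp: total_add simp del: One_nat_def)+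
    then show "{i. Q i j \<noteq> 0} \<subseteq> {i. total i \<le> total j + 1}" by blast
  qed
qed

lemma honest:
  assumes "0 \<le> t"
  shows "infsum (minimal t i) UNIV = 1"
proof -
  obtain M where M: "0 \<le> M" "\<And>k K. finite K \<Longrightarrow> axis k 1 \<notin> K \<Longrightarrow> (\<Sum>m\<in>K. b k m * total m) \<le> M"
    using bounded_mean by blast
  show ?thesis
  proof (rule minimal_honest[OF refl has_sum_row_zero _ diag_ge M(1) _ assms])
    show "0 \<le> - h 0 - a 0 - (\<Sum>k\<in>UNIV. b k (axis k 1))"
      using h.diag_nonpos a.diag_nonpos sum_nonpos[of UNIV "\<lambda>k. b k (axis k 1)"] b.diag_nonpos by simp
    fix \<eta> :: real assume \<eta>: "\<eta> > 0"
    have "eventually (\<lambda>s. - \<eta> \<le> gen_total h s \<and> - \<eta> \<le> gen_total a s) (at_left 1)"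
      by (intro eventually_conj h.eventually_gen_total_ge a.eventually_gen_total_ge \<eta>)
    then obtain r where r: "r < 1" "\<And>s. r < s \<Longrightarrow> s < 1 \<Longrightarrow> - \<eta> \<le> gen_total h s \<and> - \<eta> \<le> gen_total a s"
      by (auto simp: eventually_at_left_field)
    show "\<exists>\<delta>. 0 < \<delta> \<and> (\<forall>(s::real) i. 0 < s \<longrightarrow> 1 - \<delta> \<le> s \<longrightarrow> s < 1 \<longrightarrow>
        - (M * (1 - s) * (total i * s ^ (total i - 1))) - \<eta> \<le> (\<Sum>\<^sub>\<infinity>j. Q i j * s ^ total j))"
    \<comment> \<open>Half the distance to 1 turns the weak inequality for \<open>s\<close> into the
      strict \<open>r < s\<close>.\<close>
    proof (intro exI[of _ "(1 - r) / 2"] conjI allI impI)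
      show "0 < (1 - r) / 2" using r by simp
      fix s :: real and i assume s: "0 < s" "1 - (1 - r) / 2 \<le> s" "s < 1"
      have "r < s" using s(2) r(1) by (simp add: field_simps)
      then show "- (M * (1 - s) * (total i * s ^ (total i - 1))) - \<eta> \<le> (\<Sum>\<^sub>\<infinity>j. Q i j * s ^ total j)"
        using r(2)[of s] s \<eta> by (intro row_gen_ge M) auto
    qed
  qed
qed

end

theorem theorem2p1:
  fixes h a :: "nat ^ 'n \<Rightarrow> real"
    and b :: "'n::finite \<Rightarrow> nat ^ 'n \<Rightarrow> real"
    and Q :: "nat ^ 'n \<Rightarrow> nat ^ 'n \<Rightarrow> real"
  assumes "nTBI_qmatrix h a b Q"
    and A1: "nonsingular_B b"
    and A2: "\<forall>i j. B_partial_finite b i j 1"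
    and A3: "positively_regular (G_matrix b 1)"
  shows "\<exists>P. nTBIP Q P \<and> Feller_minimal Q P \<and>
           (\<forall>R. nTBIP Q R \<longrightarrow> (\<forall>t\<ge>0. \<forall>i j. R t i j = P t i j))"
proof -
  have Q: "Q = nTBI_matrix h a b" using assms(1) by (simp add: nTBI_qmatrix_def)
  interpret nTBI h a b
    using assms(1) A2 unfolding Q by unfold_locales auto
  have "nTBIP Q minimal"
    using assms(1) transition_function_minimal forward_equation_minimal
    unfolding nTBIP_def Q by blast
  moreover have "Feller_minimal Q minimal"
    unfolding Q by (rule Feller_minimal_minimal)
  \<comment> \<open>A forward solution is a Q-function, hence dominates \<open>minimal\<close>,
    whose rows already have mass 1.\<close>
  moreover have "R t i j = minimal t i j" if "nTBIP Q R" "0 \<le> t" for R t i j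
    using that forward_equation_imp_Q_function Q_function_eq_minimal[OF _ _ honest]
    unfolding nTBIP_def Q by blast
  ultimately show ?thesis by blast
qed

end
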